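(* For each $n\ge2$ and $k\ge1$, the codimension one foliation $\mathcal{F}$ on $\mathbb{P}^{n}$ given in an affine chart $(x_1,\dots,x_n)$ by the polynomial first integral $$F(x_1,\dots,x_n)=\sum_{i=1}^{n}x_i^{k+1}$$ is Galois with $\mathrm{Deck}(\mathcal{G}_{\mathcal{F}})\simeq(\mathbb{Z}/k\mathbb{Z})^{n-1}$.
   Context: The Gauss map of a codimension one foliation $\mathcal{F}$ on $\mathbb{P}^n$ (over $\mathbb{C}$) is the rational map $\mathcal{G}_{\mathcal{F}}:\mathbb{P}^n\dashrightarrow\check{\mathbb{P}}^n$ sending a non-singular point $p$ to the hyperplane of $\mathbb{P}^n$ tangent to $\mathcal{F}$ at $p$. $\mathcal{F}$ is non-degenerate if $\mathcal{G}_{\mathcal{F}}$ is dominant. A non-degenerate $\mathcal{F}$ is Galois if the field extension $\mathcal{G}_{\mathcal{F}}^*:\mathbb{C}(\check{\mathbb{P}}^n)\hookrightarrow\mathbb{C}(\mathbb{P}^n)$ is Galois. $\mathrm{Deck}(\mathcal{G}_{\mathcal{F}})=\{\phi\in\mathrm{Bir}(\mathbb{P}^n)\mid\mathcal{G}_{\mathcal{F}}\circ\phi=\mathcal{G}_{\mathcal{F}}\}$. *)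

theory Defs
  imports
    Complex_Main
    "HOL-Library.Poly_Mapping"
    "HOL-Computational_Algebra.Fraction_Field"
    "HOL-Algebra.Finite_Extensions"
    "HOL-Algebra.Product_Groups"
    "HOL-Algebra.Elementary_Groups"
begin

section \<open>Polynomials in the variables \<open>x\<^sub>0, x\<^sub>1, \<dots>\<close> over the complex numbers\<close>

type_synonym mpoly = "(nat \<Rightarrow>\<^sub>0 nat) \<Rightarrow>\<^sub>0 complex"

definition mvar :: "nat \<Rightarrow> mpoly" where
  "mvar i = Poly_Mapping.single (Poly_Mapping.single i 1) 1"

definition meval :: "(complex \<Rightarrow> 'a) \<Rightarrow> (nat \<Rightarrow> 'a) \<Rightarrow> mpoly \<Rightarrow> 'a::comm_semiring_1" where
  "meval h x p = (\<Sum>m\<in>Poly_Mapping.keys p.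
     h (Poly_Mapping.lookup p m) *
     (\<Prod>i\<in>Poly_Mapping.keys m. x i ^ Poly_Mapping.lookup m i))"

abbreviation point_eval :: "mpoly \<Rightarrow> (nat \<Rightarrow> complex) \<Rightarrow> complex" where
  "point_eval p x \<equiv> meval (\<lambda>c. c) x p"

abbreviation msubst :: "(nat \<Rightarrow> mpoly) \<Rightarrow> mpoly \<Rightarrow> mpoly" where
  "msubst g p \<equiv> meval (Poly_Mapping.single 0) g p"

text \<open>The coefficient below vanishes when \<open>x\<^sub>i\<close> does not occur in the monomial, so the
  truncated subtraction of exponents does no harm.\<close>

definition mpderiv :: "nat \<Rightarrow> mpoly \<Rightarrow> mpoly" where
  "mpderiv i p = (\<Sum>m\<in>Poly_Mapping.keys p.
     Poly_Mapping.single (m - Poly_Mapping.single i 1)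
       (of_nat (Poly_Mapping.lookup m i) * Poly_Mapping.lookup p m))"

definition forms :: "nat \<Rightarrow> nat \<Rightarrow> mpoly set" where
  "forms n d = {p. \<forall>m\<in>Poly_Mapping.keys p. Poly_Mapping.keys m \<subseteq> {..n} \<and>
     (\<Sum>i\<in>Poly_Mapping.keys m. Poly_Mapping.lookup m i) = d}"

section \<open>Rational self-maps of projective space\<close>

text \<open>A rational map from \<open>\<P>\<^sup>n\<close> to \<open>\<P>\<^sup>n\<close> is a class of tuples \<open>[f\<^sub>0 : \<dots> : f\<^sub>n]\<close> of homogeneous
  polynomials of one common degree, not all zero, modulo proportionality. Tuples are
  functions on the naturals that vanish beyond \<open>n\<close>. The dual projective space is
  identified with \<open>\<P>\<^sup>n\<close>: the hyperplane \<open>a\<^sub>0 x\<^sub>0 + \<dots> + a\<^sub>n x\<^sub>n = 0\<close> has coordinates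
  \<open>[a\<^sub>0 : \<dots> : a\<^sub>n]\<close>.\<close>

definition hom_tuples :: "nat \<Rightarrow> (nat \<Rightarrow> mpoly) set" where
  "hom_tuples n = {f. (\<exists>d. \<forall>i\<le>n. f i \<in> forms n d) \<and> (\<exists>i\<le>n. f i \<noteq> 0) \<and> (\<forall>i>n. f i = 0)}"

definition proportional :: "nat \<Rightarrow> ((nat \<Rightarrow> mpoly) \<times> (nat \<Rightarrow> mpoly)) set" where
  "proportional n = {(f, g). f \<in> hom_tuples n \<and> g \<in> hom_tuples n \<and>
     (\<forall>i\<le>n. \<forall>j\<le>n. f i * g j = f j * g i)}"

definition rational_maps :: "nat \<Rightarrow> (nat \<Rightarrow> mpoly) set set" where
  "rational_maps n = hom_tuples n // proportional n"

definition ratmap :: "nat \<Rightarrow> (nat \<Rightarrow> mpoly) \<Rightarrow> (nat \<Rightarrow> mpoly) set" where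
  "ratmap n f = proportional n `` {f}"

definition ratmap_id :: "nat \<Rightarrow> (nat \<Rightarrow> mpoly) set" where
  "ratmap_id n = ratmap n (\<lambda>i. if i \<le> n then mvar i else 0)"

text \<open>All representatives whose substitution is not identically zero give the same class. If
  there are none, the composite is undefined as a rational map and the set below is empty.\<close>

definition ratmap_comp ::
  "nat \<Rightarrow> (nat \<Rightarrow> mpoly) set \<Rightarrow> (nat \<Rightarrow> mpoly) set \<Rightarrow> (nat \<Rightarrow> mpoly) set" where
  "ratmap_comp n \<phi> \<psi> =
     {h. \<exists>f\<in>\<phi>. \<exists>g\<in>\<psi>. ((\<lambda>i. msubst g (f i)), h) \<in> proportional n}"

text \<open>Dominance: the image, formed over all points at which some representative is defined, is
  Zariski dense, i.e. the only homogeneous polynomial vanishing on it is zero.\<close>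

definition dominant :: "nat \<Rightarrow> (nat \<Rightarrow> mpoly) set \<Rightarrow> bool" where
  "dominant n \<phi> \<longleftrightarrow> (\<forall>d. \<forall>P\<in>forms n d.
     (\<forall>f\<in>\<phi>. \<forall>x. (\<exists>i\<le>n. point_eval (f i) x \<noteq> 0) \<longrightarrow>
        point_eval P (\<lambda>i. point_eval (f i) x) = 0) \<longrightarrow> P = 0)"

definition bir_group :: "nat \<Rightarrow> (nat \<Rightarrow> mpoly) set monoid" where
  "bir_group n =
     \<lparr>carrier = {\<phi> \<in> rational_maps n. \<exists>\<psi>\<in>rational_maps n.
        ratmap_comp n \<phi> \<psi> = ratmap_id n \<and> ratmap_comp n \<psi> \<phi> = ratmap_id n},
      monoid.mult = ratmap_comp n,
      one = ratmap_id n\<rparr>"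

definition deck_group :: "nat \<Rightarrow> (nat \<Rightarrow> mpoly) set \<Rightarrow> (nat \<Rightarrow> mpoly) set monoid" where
  "deck_group n G =
     (bir_group n)\<lparr>carrier := {\<phi> \<in> carrier (bir_group n). ratmap_comp n G \<phi> = G}\<rparr>"

section \<open>Function fields and Galois extensions\<close>

text \<open>The function field of \<open>\<P>\<^sup>n\<close>: quotients of homogeneous polynomials of equal degree.\<close>

definition function_field :: "nat \<Rightarrow> mpoly fract ring" where
  "function_field n =
     \<lparr>carrier = {Fraction_Field.Fract P Q | P Q. Q \<noteq> 0 \<and> (\<exists>d. P \<in> forms n d \<and> Q \<in> forms n d)},
      monoid.mult = (*), one = 1, zero = 0, add = (+)\<rparr>"

text \<open>The pullback of \<open>P/Q\<close> along \<open>[g\<^sub>0 : \<dots> : g\<^sub>n]\<close> is \<open>P(g)/Q(g)\<close>. For a dominant map \<open>Q(g)\<close>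
  never vanishes and the value does not depend on the choice of \<open>P\<close>, \<open>Q\<close>, \<open>g\<close>.\<close>

definition pullback :: "nat \<Rightarrow> (nat \<Rightarrow> mpoly) set \<Rightarrow> mpoly fract \<Rightarrow> mpoly fract" where
  "pullback n \<phi> z = (THE w. \<exists>g\<in>\<phi>. \<exists>d. \<exists>P\<in>forms n d. \<exists>Q\<in>forms n d.
     Q \<noteq> 0 \<and> z = Fraction_Field.Fract P Q \<and> w = Fraction_Field.Fract (msubst g P) (msubst g Q))"

text \<open>\<open>R/K\<close> is Galois: algebraic, normal (minimal polynomials split in \<open>R\<close>) and separable
  (minimal polynomials have only simple roots; by normality all of them lie in \<open>R\<close>).\<close>

definition (in ring) galois_over :: "'a set \<Rightarrow> bool" where
  "galois_over K \<longleftrightarrow> subfield K R \<and>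
     (\<forall>a\<in>carrier R. (algebraic over K) a \<and> splitted (Irr K a) \<and>
        (\<forall>b. count (roots (Irr K a)) b \<le> 1))"

section \<open>Codimension one foliations on projective space\<close>

text \<open>A foliation is given by a homogeneous 1-form \<open>\<omega> = \<Sum> \<omega>\<^sub>i dx\<^sub>i\<close> on affine \<open>(n+1)\<close>-space,
  determined up to a nonzero scalar. The conditions are contraction with the radial vector
  field being zero, Frobenius integrability \<open>\<omega> \<and> d\<omega> = 0\<close>, and singular set of codimension at
  least two, i.e. no nonconstant common factor of the coefficients.\<close>

definition codim1_foliation :: "nat \<Rightarrow> (nat \<Rightarrow> mpoly) \<Rightarrow> bool" where
  "codim1_foliation n \<omega> \<longleftrightarrow> \<omega> \<in> hom_tuples n \<and>
     (\<Sum>i\<le>n. mvar i * \<omega> i) = 0 \<and>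
     (\<forall>i\<le>n. \<forall>j\<le>n. \<forall>l\<le>n.
        \<omega> i * (mpderiv j (\<omega> l) - mpderiv l (\<omega> j)) +
        \<omega> j * (mpderiv l (\<omega> i) - mpderiv i (\<omega> l)) +
        \<omega> l * (mpderiv i (\<omega> j) - mpderiv j (\<omega> i)) = 0) \<and>
     (\<forall>h. (\<forall>i\<le>n. h dvd \<omega> i) \<longrightarrow> h dvd 1)"

text \<open>Restriction to the affine chart \<open>x\<^sub>0 = 1\<close> with coordinates \<open>x\<^sub>1, \<dots>, x\<^sub>n\<close>.\<close>

definition dehom :: "mpoly \<Rightarrow> mpoly" where
  "dehom p = msubst (\<lambda>i. if i = 0 then 1 else mvar i) p"

text \<open>\<open>F\<close> is a nonconstant polynomial in \<open>x\<^sub>1, \<dots>, x\<^sub>n\<close> with \<open>\<omega> \<and> dF = 0\<close> in the affine chart. This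
  determines the foliation.\<close>

definition polynomial_first_integral :: "nat \<Rightarrow> (nat \<Rightarrow> mpoly) \<Rightarrow> mpoly \<Rightarrow> bool" where
  "polynomial_first_integral n \<omega> F \<longleftrightarrow>
     (\<forall>m\<in>Poly_Mapping.keys F. Poly_Mapping.keys m \<subseteq> {1..n}) \<and>
     (\<exists>i\<in>{1..n}. mpderiv i F \<noteq> 0) \<and>
     (\<forall>i\<in>{1..n}. \<forall>j\<in>{1..n}. dehom (\<omega> i) * mpderiv j F = dehom (\<omega> j) * mpderiv i F)"

text \<open>The tangent hyperplane at a nonsingular point \<open>p\<close> is \<open>\<Sum> \<omega>\<^sub>i(p) x\<^sub>i = 0\<close>.\<close>

definition gauss_map :: "nat \<Rightarrow> (nat \<Rightarrow> mpoly) \<Rightarrow> (nat \<Rightarrow> mpoly) set" where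
  "gauss_map n \<omega> = ratmap n \<omega>"

definition nondegenerate_foliation :: "nat \<Rightarrow> (nat \<Rightarrow> mpoly) \<Rightarrow> bool" where
  "nondegenerate_foliation n \<omega> \<longleftrightarrow> dominant n (gauss_map n \<omega>)"

definition galois_foliation :: "nat \<Rightarrow> (nat \<Rightarrow> mpoly) \<Rightarrow> bool" where
  "galois_foliation n \<omega> \<longleftrightarrow> nondegenerate_foliation n \<omega> \<and>
     ring.galois_over (function_field n)
       (pullback n (gauss_map n \<omega>) ` carrier (function_field n))"

end

theory Submission
  imports Defs "HOL-Computational_Algebra.Factorial_Ring"
begin

text \<open>Write \<open>F\<close> for the Fermat polynomial \<open>x\<^sub>1\<^sup>k\<^sup>+\<^sup>1 + \<dots> + x\<^sub>n\<^sup>k\<^sup>+\<^sup>1\<close>. The foliation is defined by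
  \<open>x\<^sub>0\<^sup>k\<^sup>+\<^sup>2 d(F / x\<^sub>0\<^sup>k\<^sup>+\<^sup>1)\<close>, so its Gauss map is
  \<open>G = [- F : x\<^sub>0 x\<^sub>1\<^sup>k : \<dots> : x\<^sub>0 x\<^sub>n\<^sup>k]\<close>; the first integral and the contraction with the radial
  vector field leave no other possibility (\<open>proportional_fermat_form\<close>).

  One change of variables explains the rest. Put \<open>u = F / x\<^sub>0\<close> and give it weight \<open>k\<close>. Since
  \<open>x\<^sub>0 = F / u\<close>, the function field consists of the fractions of weight zero in
  \<open>u, x\<^sub>1, \<dots>, x\<^sub>n\<close>, and \<open>G = [- u : x\<^sub>1\<^sup>k : \<dots> : x\<^sub>n\<^sup>k]\<close> is a power map. Its symmetries multiply
  each \<open>x\<^sub>i\<close> by a \<open>k\<close>-th root of unity \<open>\<zeta>\<^sub>i\<close> and fix \<open>u\<close>. In the original coordinates they are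
  \<open>[x\<^sub>0 F\<^sub>\<zeta> : \<zeta>\<^sub>1 x\<^sub>1 F : \<dots> : \<zeta>\<^sub>n x\<^sub>n F]\<close> with \<open>F\<^sub>\<zeta> = \<zeta>\<^sub>1 x\<^sub>1\<^sup>k\<^sup>+\<^sup>1 + \<dots> + \<zeta>\<^sub>n x\<^sub>n\<^sup>k\<^sup>+\<^sup>1\<close>. A common factor
  of the \<open>\<zeta>\<^sub>i\<close> does not matter, so these maps form a group isomorphic to \<open>(\<int>/k)\<^sup>n\<^sup>-\<^sup>1\<close>.

  Every deck transformation is of this form: it preserves the \<open>k\<close>-th powers of the ratios
  \<open>x\<^sub>i / x\<^sub>n\<close>, hence multiplies the ratios by roots of unity, and it preserves \<open>F / x\<^sub>0\<close> up to the
  scaling of the coordinates (\<open>deck_group_cases\<close>). For the Galois property it suffices that every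
  rational function invariant under these maps is a pullback along \<open>G\<close>
  (\<open>galois_over_fixed_field\<close>, in the manner of Artin). In the variables \<open>u, x\<^sub>1, \<dots>, x\<^sub>n\<close> an invariant
  fraction can be written with invariant numerator and denominator, which contain only
  \<open>k\<close>-th powers of the \<open>x\<^sub>i\<close> (\<open>invariant_fraction\<close>).

  Polynomial identities are checked at points outside a hypersurface (\<open>mpoly_eqI\<close>), where the
  rational substitutions above have values.\<close>

section \<open>Polynomials as functions\<close>

abbreviation mconst :: "complex \<Rightarrow> mpoly" where
  "mconst c \<equiv> Poly_Mapping.single 0 c"

definition monomial_eval :: "(nat \<Rightarrow> 'a::comm_semiring_1) \<Rightarrow> (nat \<Rightarrow>\<^sub>0 nat) \<Rightarrow> 'a" where
  "monomial_eval x m = (\<Prod>i\<in>Poly_Mapping.keys m. x i ^ Poly_Mapping.lookup m i)"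

lemma monomial_eval_superset:
  assumes "finite I" "Poly_Mapping.keys m \<subseteq> I"
  shows "monomial_eval x m = (\<Prod>i\<in>I. x i ^ Poly_Mapping.lookup m i)"
  unfolding monomial_eval_def using assms
  by (intro prod.mono_neutral_left) (auto simp: in_keys_iff)

lemma monomial_eval_zero [simp]: "monomial_eval x 0 = 1"
  by (simp add: monomial_eval_def)

lemma monomial_eval_add: "monomial_eval x (m + m') = monomial_eval x m * monomial_eval x m'"
proof -
  let ?I = "Poly_Mapping.keys m \<union> Poly_Mapping.keys m'"
  have "Poly_Mapping.keys (m + m') \<subseteq> ?I"
    by (rule keys_add)
  then have "monomial_eval x (m + m') = (\<Prod>i\<in>?I. x i ^ Poly_Mapping.lookup (m + m') i)"
    by (intro monomial_eval_superset) auto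
  also have "\<dots> = monomial_eval x m * monomial_eval x m'"
    by (simp add: monomial_eval_superset[of ?I m] monomial_eval_superset[of ?I m'] lookup_add power_add prod.distrib)
  finally show ?thesis .
qed

lemma monomial_eval_single [simp]: "monomial_eval x (Poly_Mapping.single i e) = x i ^ e"
  by (simp add: monomial_eval_def)

lemma monomial_eval_mult: "monomial_eval (\<lambda>i. x i * y i) m = monomial_eval x m * monomial_eval y m"
  by (simp add: monomial_eval_def power_mult_distrib prod.distrib)

lemma monomial_eval_cong: "(\<And>i. i \<in> Poly_Mapping.keys m \<Longrightarrow> x i = y i) \<Longrightarrow> monomial_eval x m = monomial_eval y m"
  by (simp add: monomial_eval_def)

lemma monomial_eval_scale_one: "monomial_eval (\<lambda>j. if j = i then c else 1) m = c ^ Poly_Mapping.lookup m i"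
proof -
  have "monomial_eval (\<lambda>j. if j = i then c else 1) m =
      (\<Prod>j\<in>insert i (Poly_Mapping.keys m). (if j = i then c else 1) ^ Poly_Mapping.lookup m j)"
    by (intro monomial_eval_superset) auto
  also have "\<dots> = (\<Prod>j\<in>insert i (Poly_Mapping.keys m). if j = i then c ^ Poly_Mapping.lookup m i else 1)"
    by (intro prod.cong) auto
  also have "\<dots> = c ^ Poly_Mapping.lookup m i"
    by (simp add: prod.delta)
  finally show ?thesis .
qed

lemma mpoly_sum_monomials:
  "(p :: 'a \<Rightarrow>\<^sub>0 'b::comm_monoid_add) =
     (\<Sum>m\<in>Poly_Mapping.keys p. Poly_Mapping.single m (Poly_Mapping.lookup p m))"
  by (rule poly_mapping_eqI)
     (auto simp: lookup_sum lookup_single when_def in_keys_iff)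

lemma meval_eq_sum_monomials: "meval h x p =
    (\<Sum>m\<in>Poly_Mapping.keys p. h (Poly_Mapping.lookup p m) * monomial_eval x m)"
  by (simp add: meval_def monomial_eval_def)

text \<open>Both evaluation at a point and substitution of polynomials are instances of one
  homomorphism, which applies a ring homomorphism to the coefficients.\<close>

locale coeff_hom =
  fixes h :: "complex \<Rightarrow> 'a::comm_ring_1"
  assumes h_zero: "h 0 = 0" and h_one: "h 1 = 1"
    and h_add: "h (a + b) = h a + h b" and h_mult: "h (a * b) = h a * h b"
begin

lemma meval_superset:
  assumes "finite I" "Poly_Mapping.keys p \<subseteq> I"
  shows "meval h x p = (\<Sum>m\<in>I. h (Poly_Mapping.lookup p m) * monomial_eval x m)"
  unfolding meval_eq_sum_monomials using assms
  by (intro sum.mono_neutral_left) (auto simp: in_keys_iff h_zero)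

lemma meval_zero [simp]: "meval h x 0 = 0"
  by (simp add: meval_def)

lemma meval_add [simp]: "meval h x (p + q) = meval h x p + meval h x q"
proof -
  let ?I = "Poly_Mapping.keys p \<union> Poly_Mapping.keys q"
  have "meval h x (p + q) = (\<Sum>m\<in>?I. h (Poly_Mapping.lookup (p + q) m) * monomial_eval x m)"
    by (intro meval_superset keys_add) auto
  also have "\<dots> = meval h x p + meval h x q"
    by (simp add: meval_superset[of ?I p] meval_superset[of ?I q] lookup_add h_add
        distrib_right sum.distrib)
  finally show ?thesis .
qed

lemma meval_sum [simp]: "meval h x (\<Sum>i\<in>I. f i) = (\<Sum>i\<in>I. meval h x (f i))"
  by (induction I rule: infinite_finite_induct) auto

lemma meval_single [simp]: "meval h x (Poly_Mapping.single m c) = h c * monomial_eval x m"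
  by (cases "c = 0") (auto simp: meval_eq_sum_monomials h_zero)

lemma meval_mult [simp]: "meval h x (p * q) = meval h x p * meval h x q"
proof -
  let ?s = "\<lambda>p m. Poly_Mapping.single m (Poly_Mapping.lookup p m) :: mpoly"
  have "p * q = (\<Sum>m\<in>Poly_Mapping.keys p. \<Sum>m'\<in>Poly_Mapping.keys q. ?s p m * ?s q m')"
    by (subst (1) mpoly_sum_monomials[of p], subst (1) mpoly_sum_monomials[of q])
       (simp add: sum_product)
  then have "meval h x (p * q) = (\<Sum>m\<in>Poly_Mapping.keys p. \<Sum>m'\<in>Poly_Mapping.keys q.
      (h (Poly_Mapping.lookup p m) * monomial_eval x m) * (h (Poly_Mapping.lookup q m') * monomial_eval x m'))"
    by (simp add: mult_single h_mult monomial_eval_add mult_ac)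
  also have "\<dots> = meval h x p * meval h x q"
    by (simp add: meval_eq_sum_monomials sum_product)
  finally show ?thesis .
qed

lemma meval_one [simp]: "meval h x 1 = 1"
  using meval_single[of x 0 1] by (simp add: h_one del: meval_single)

lemma meval_power [simp]: "meval h x (p ^ e) = meval h x p ^ e"
  by (induction e) auto

lemma meval_prod [simp]: "meval h x (\<Prod>i\<in>I. f i) = (\<Prod>i\<in>I. meval h x (f i))"
  by (induction I rule: infinite_finite_induct) auto

lemma meval_uminus [simp]: "meval h x (- p) = - meval h x p"
  using meval_add[of x p "- p"] by (simp add: eq_neg_iff_add_eq_0 add.commute del: meval_add)

lemma meval_diff [simp]: "meval h x (p - q) = meval h x p - meval h x q"
  using meval_add[of x p "- q"] by (simp del: meval_add)

lemma meval_mvar [simp]: "meval h x (mvar i) = x i"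
  by (simp add: mvar_def h_one)

end

interpretation point: coeff_hom "\<lambda>c. c"
  by unfold_locales auto

interpretation subst: coeff_hom "Poly_Mapping.single 0 :: complex \<Rightarrow> mpoly"
  by unfold_locales (auto simp: single_add mult_single)

lemma point_eval_msubst [simp]:
  "point_eval (msubst g p) x = point_eval p (\<lambda>i. point_eval (g i) x)"
  by (simp add: meval_eq_sum_monomials[of "Poly_Mapping.single 0"] meval_eq_sum_monomials[of _ _ p] monomial_eval_def)

text \<open>A diagonal change of coordinates multiplies each monomial by a scalar. This torus action
  is the device that isolates single coefficients below.\<close>

definition mscale :: "(nat \<Rightarrow> complex) \<Rightarrow> mpoly \<Rightarrow> mpoly" where
  "mscale c p = Poly_Mapping.mapp (\<lambda>m a. monomial_eval c m * a) p"

lemma lookup_mscale [simp]: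
  "Poly_Mapping.lookup (mscale c p) m = monomial_eval c m * Poly_Mapping.lookup p m"
  by (simp add: mscale_def lookup_mapp when_def in_keys_iff)

lemma keys_mscale_subset: "Poly_Mapping.keys (mscale c p) \<subseteq> Poly_Mapping.keys p"
  by (auto simp: in_keys_iff)

lemma point_eval_mscale [simp]: "point_eval (mscale c p) x = point_eval p (\<lambda>i. c i * x i)"
  by (simp add: point.meval_superset[OF _ keys_mscale_subset] meval_eq_sum_monomials[of _ _ p] monomial_eval_mult mult_ac)

text \<open>A nonzero polynomial of least number of terms that vanishes everywhere cannot have two
  different monomials: rescaling a variable in which they differ and subtracting a multiple
  kills one of them and not the other.\<close>

lemma mpoly_zeroI:
  assumes "\<And>x. point_eval p x = 0"
  shows "p = 0"
  using assms
proof (induction "card (Poly_Mapping.keys p)" arbitrary: p rule: less_induct)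
  case less
  show ?case
  proof (rule ccontr)
    assume "p \<noteq> 0"
    then obtain m where m: "m \<in> Poly_Mapping.keys p"
      by (metis all_not_in_conv keys_eq_empty)
    show False
    proof (cases "Poly_Mapping.keys p = {m}")
      case True
      have "point_eval p (\<lambda>_. 1) = Poly_Mapping.lookup p m"
        using True by (simp add: meval_eq_sum_monomials monomial_eval_def)
      with less.prems m show False
        by (auto simp: in_keys_iff)
    next
      case False
      with m obtain m' where m': "m' \<in> Poly_Mapping.keys p" "m' \<noteq> m"
        by blast
      then obtain i where i: "Poly_Mapping.lookup m i \<noteq> Poly_Mapping.lookup m' i"
        by (metis poly_mapping_eqI)
      \<comment> \<open>Powers of 2 with different exponents are different.\<close>
      define c :: "nat \<Rightarrow> complex" where "c = (\<lambda>j. if j = i then 2 else 1)"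
      have c: "monomial_eval c l = 2 ^ Poly_Mapping.lookup l i" for l
        unfolding c_def by (rule monomial_eval_scale_one)
      define q where "q = mscale c p - mconst (monomial_eval c m) * p"
      have lq: "Poly_Mapping.lookup q l = (monomial_eval c l - monomial_eval c m) * Poly_Mapping.lookup p l" for l
        unfolding q_def mult_map_scale_conv_mult[symmetric]
        by (simp add: lookup_minus Poly_Mapping.map.rep_eq when_def algebra_simps)
      have sub: "Poly_Mapping.keys q \<subset> Poly_Mapping.keys p"
        using m by (auto simp: in_keys_iff lq)
      have "q = 0"
        using less.prems sub
        by (intro less.hyps psubset_card_mono) (auto simp: q_def)
      then have "(2::complex) ^ Poly_Mapping.lookup m' i = 2 ^ Poly_Mapping.lookup m i"
        using lq[of m'] m' by (simp add: in_keys_iff c)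
      then have "norm ((2::complex) ^ Poly_Mapping.lookup m' i) = norm ((2::complex) ^ Poly_Mapping.lookup m i)"
        by simp
      then show False
        using i by (simp add: norm_power)
    qed
  qed
qed

lemma mpoly_eqI:
  assumes "h \<noteq> 0" and "\<And>x. point_eval h x \<noteq> 0 \<Longrightarrow> point_eval p x = point_eval q x"
  shows "p = q"
proof -
  have "h * (p - q) = 0"
    using assms(2) by (intro mpoly_zeroI) (auto simp: )
  with assms(1) show ?thesis
    by simp
qed

lemma mpoly_eq_iff: "p = q \<longleftrightarrow> (\<forall>x. point_eval p x = point_eval q x)"
  using mpoly_eqI[of 1 p q] by auto

lemma mconst_eq_0_iff [simp]: "mconst a = 0 \<longleftrightarrow> a = 0"
  by (metis lookup_single_eq lookup_zero single_zero)

lemma mscale_mscale: "mscale c (mscale c' p) = mscale (\<lambda>i. c i * c' i) p"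
  by (simp add: mpoly_eq_iff mult_ac)

lemma mscale_mult: "mscale c (p * q) = mscale c p * mscale c q"
  by (simp add: mpoly_eq_iff)

lemma mscale_prod: "mscale c (\<Prod>i\<in>I. f i) = (\<Prod>i\<in>I. mscale c (f i))"
  by (simp add: mpoly_eq_iff)

lemma mscale_one: "mscale (\<lambda>_. 1) p = p"
  by (simp add: mpoly_eq_iff)

lemma mscale_mconst [simp]: "mscale c (mconst a) = mconst a"
  by (simp add: mpoly_eq_iff)

text \<open>Semi-invariance under one element of the torus is thus a condition on the exponents.\<close>

lemma weight_of_semi_invariant:
  assumes "\<And>x. point_eval p (\<lambda>i. c i * x i) = a * point_eval p x"
    and "m \<in> Poly_Mapping.keys p"
  shows "monomial_eval c m = a"
proof -
  have "mscale c p = mconst a * p"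
    using assms(1) by (simp add: mpoly_eq_iff)
  then have "monomial_eval c m * Poly_Mapping.lookup p m = Poly_Mapping.lookup (mconst a * p) m"
    by (metis lookup_mscale)
  then show ?thesis
    using assms(2) unfolding mult_map_scale_conv_mult[symmetric]
    by (simp add: Poly_Mapping.map.rep_eq when_def in_keys_iff)
qed

lemma mscale_eq_0_iff:
  assumes "\<And>i. c i \<noteq> 0"
  shows "mscale c p = 0 \<longleftrightarrow> p = 0"
proof -
  have "monomial_eval c m \<noteq> 0" for m
    using assms by (simp add: monomial_eval_def)
  then show ?thesis
    by (simp add: poly_mapping_eq_iff fun_eq_iff)
qed

section \<open>Forms\<close>

lemma forms_iff: "p \<in> forms n d \<longleftrightarrow> (\<forall>m\<in>Poly_Mapping.keys p.
    Poly_Mapping.keys m \<subseteq> {..n} \<and> (\<Sum>i\<le>n. Poly_Mapping.lookup m i) = d)"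
proof -
  have "(\<Sum>i\<in>Poly_Mapping.keys m. Poly_Mapping.lookup m i) = (\<Sum>i\<le>n. Poly_Mapping.lookup m i)"
    if "Poly_Mapping.keys m \<subseteq> {..n}" for m :: "nat \<Rightarrow>\<^sub>0 nat"
    using that by (intro sum.mono_neutral_left) (auto simp: in_keys_iff)
  then show ?thesis
    unfolding forms_def by auto
qed

lemma forms_zero [simp, intro]: "0 \<in> forms n d"
  by (simp add: forms_iff)

lemma forms_add [intro]: "p \<in> forms n d \<Longrightarrow> q \<in> forms n d \<Longrightarrow> p + q \<in> forms n d"
  using keys_add[of p q] by (auto simp: forms_iff)

lemma forms_uminus [intro]: "p \<in> forms n d \<Longrightarrow> - p \<in> forms n d"
  by (auto simp: forms_iff in_keys_iff)

lemma forms_mult [intro]: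
  assumes "p \<in> forms n d" "q \<in> forms n e"
  shows "p * q \<in> forms n (d + e)"
  unfolding forms_iff
proof
  fix m assume "m \<in> Poly_Mapping.keys (p * q)"
  then obtain a b where ab: "a \<in> Poly_Mapping.keys p" "b \<in> Poly_Mapping.keys q" "m = a + b"
    using keys_mult[of p q] by auto
  then show "Poly_Mapping.keys m \<subseteq> {..n} \<and> (\<Sum>i\<le>n. Poly_Mapping.lookup m i) = d + e"
    using assms keys_add[of a b] by (fastforce simp: forms_iff lookup_add sum.distrib)
qed

lemma forms_sum [intro]: "(\<And>i. i \<in> I \<Longrightarrow> f i \<in> forms n d) \<Longrightarrow> (\<Sum>i\<in>I. f i) \<in> forms n d"
  by (induction I rule: infinite_finite_induct) auto

lemma forms_const [intro]: "mconst c \<in> forms n 0"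
  by (auto simp: forms_iff)

lemma forms_one [intro]: "1 \<in> forms n 0"
  using forms_const[of 1 n] by simp

lemma forms_mvar [intro]: "i \<le> n \<Longrightarrow> mvar i \<in> forms n 1"
  by (auto simp: forms_iff mvar_def lookup_single when_def)

lemma forms_power [intro]: "p \<in> forms n d \<Longrightarrow> p ^ e \<in> forms n (e * d)"
  by (induction e) auto

lemma forms_prod:
  "finite I \<Longrightarrow> (\<And>i. i \<in> I \<Longrightarrow> f i \<in> forms n (d i)) \<Longrightarrow> (\<Prod>i\<in>I. f i) \<in> forms n (\<Sum>i\<in>I. d i)"
  by (induction I rule: finite_induct) auto

lemma forms_msubst:
  assumes p: "p \<in> forms n d" and g: "\<And>i. i \<le> n \<Longrightarrow> g i \<in> forms n e"
  shows "msubst g p \<in> forms n (d * e)"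
  unfolding meval_eq_sum_monomials
proof (rule forms_sum)
  fix m assume m: "m \<in> Poly_Mapping.keys p"
  then have sub: "Poly_Mapping.keys m \<subseteq> {..n}" and d: "(\<Sum>i\<le>n. Poly_Mapping.lookup m i) = d"
    using p by (auto simp: forms_iff)
  have "monomial_eval g m \<in> forms n (\<Sum>i\<le>n. Poly_Mapping.lookup m i * e)"
    using sub g by (subst monomial_eval_superset[of "{..n}"]) (auto intro!: forms_prod forms_power)
  moreover have "(\<Sum>i\<le>n. Poly_Mapping.lookup m i * e) = d * e"
    using d by (simp flip: sum_distrib_right)
  ultimately show "mconst (Poly_Mapping.lookup p m) * monomial_eval g m \<in> forms n (d * e)"
    using forms_mult[OF forms_const] by fastforce
qed

lemma point_eval_form:
  assumes p: "p \<in> forms n d" and y: "\<And>i. i \<le> n \<Longrightarrow> y i = c * x i"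
  shows "point_eval p y = c ^ d * point_eval p x"
proof -
  have "monomial_eval y m = c ^ d * monomial_eval x m" if m: "m \<in> Poly_Mapping.keys p" for m
  proof -
    have sub: "Poly_Mapping.keys m \<subseteq> {..n}" and d: "(\<Sum>i\<le>n. Poly_Mapping.lookup m i) = d"
      using p m by (auto simp: forms_iff)
    have "monomial_eval y m = (\<Prod>i\<le>n. (c * x i) ^ Poly_Mapping.lookup m i)"
      using y by (subst monomial_eval_superset[OF _ sub]) auto
    also have "\<dots> = c ^ d * monomial_eval x m"
      by (simp add: power_mult_distrib prod.distrib monomial_eval_superset[OF _ sub] flip: d power_sum)
    finally show ?thesis .
  qed
  then show ?thesis
    by (simp add: meval_eq_sum_monomials sum_distrib_left mult_ac)
qed

lemma point_eval_form_cong: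
  assumes "p \<in> forms n d" and "\<And>i. i \<le> n \<Longrightarrow> y i = x i"
  shows "point_eval p y = point_eval p x"
  using point_eval_form[of p n d y 1 x] assms by simp

section \<open>Rational maps\<close>

lemma hom_tuples_degreeE:
  assumes "f \<in> hom_tuples n"
  obtains d where "\<And>i. i \<le> n \<Longrightarrow> f i \<in> forms n d"
  using assms by (auto simp: hom_tuples_def)

lemma hom_tuples_nonzeroE:
  assumes "f \<in> hom_tuples n"
  obtains l where "l \<le> n" and "f l \<noteq> 0"
  using assms by (auto simp: hom_tuples_def)

lemma hom_tuplesI:
  assumes "\<And>i. i \<le> n \<Longrightarrow> f i \<in> forms n d" and "l \<le> n" "f l \<noteq> 0" and "\<And>i. i > n \<Longrightarrow> f i = 0"
  shows "f \<in> hom_tuples n"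
  using assms by (auto simp: hom_tuples_def)

lemma proportionalD:
  "(f, g) \<in> proportional n \<Longrightarrow> i \<le> n \<Longrightarrow> j \<le> n \<Longrightarrow> f i * g j = f j * g i"
  by (auto simp: proportional_def)

lemma proportional_sym: "(f, g) \<in> proportional n \<Longrightarrow> (g, f) \<in> proportional n"
  by (auto simp: proportional_def mult.commute)

lemma proportional_refl: "f \<in> hom_tuples n \<Longrightarrow> (f, f) \<in> proportional n"
  by (auto simp: proportional_def mult.commute)

lemma proportional_trans:
  assumes fg: "(f, g) \<in> proportional n" and gh: "(g, h) \<in> proportional n"
  shows "(f, h) \<in> proportional n"
proof -
  obtain l where l: "l \<le> n" "g l \<noteq> 0"
    using fg by (auto simp: proportional_def hom_tuples_def)
  have "f i * h j = f j * h i" if ij: "i \<le> n" "j \<le> n" for i j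
  proof -
    have "g l * (f i * h j) = (f i * g l) * h j"
      by simp
    also have "\<dots> = f l * (g i * h j)"
      using proportionalD[OF fg ij(1) l(1)] by simp
    also have "\<dots> = (f l * g j) * h i"
      using proportionalD[OF gh ij] by simp
    also have "\<dots> = g l * (f j * h i)"
      using proportionalD[OF fg l(1) ij(2)] by simp
    finally show ?thesis
      using l(2) by simp
  qed
  with fg gh show ?thesis
    by (auto simp: proportional_def)
qed

text \<open>A proportionality factor is visible already in one nonzero coordinate of each tuple.\<close>

lemma proportionalI:
  assumes f: "f \<in> hom_tuples n" and g: "g \<in> hom_tuples n" and l: "l \<le> n" "f l \<noteq> 0" "g l \<noteq> 0"
    and eq: "\<And>i. i \<le> n \<Longrightarrow> f i * g l = f l * g i"
  shows "(f, g) \<in> proportional n"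
proof -
  have "f i * g j = f j * g i" if ij: "i \<le> n" "j \<le> n" for i j
  proof -
    have "f l * g l * (f i * g j) = (f i * g l) * (f l * g j)"
      by simp
    also have "\<dots> = (f l * g i) * (f j * g l)"
      by (simp only: eq[OF ij(1)] eq[OF ij(2)])
    also have "\<dots> = f l * g l * (f j * g i)"
      by simp
    finally show ?thesis
      using l by simp
  qed
  with f g show ?thesis
    by (auto simp: proportional_def)
qed

lemma ratmap_eq_iff:
  assumes "f \<in> hom_tuples n" "g \<in> hom_tuples n"
  shows "ratmap n f = ratmap n g \<longleftrightarrow> (f, g) \<in> proportional n"
  using assms unfolding ratmap_def
  by (auto intro: proportional_refl proportional_sym proportional_trans)

lemma mem_ratmap [simp]: "f \<in> hom_tuples n \<Longrightarrow> f \<in> ratmap n f"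
  by (simp add: ratmap_def proportional_refl)

lemma mem_ratmapD: "g \<in> ratmap n f \<Longrightarrow> (f, g) \<in> proportional n"
  by (simp add: ratmap_def)

lemma ratmap_in_rational_maps [intro]: "f \<in> hom_tuples n \<Longrightarrow> ratmap n f \<in> rational_maps n"
  by (auto simp: rational_maps_def ratmap_def quotient_def)

lemma rational_mapsE:
  assumes "\<phi> \<in> rational_maps n"
  obtains f where "f \<in> hom_tuples n" "\<phi> = ratmap n f"
  using assms by (auto simp: rational_maps_def ratmap_def quotient_def)

text \<open>Both sides are the value of the form at the tuple \<open>f\<^sub>j g = g\<^sub>j f\<close>.\<close>

lemma msubst_proportional:
  assumes fg: "(f, g) \<in> proportional n" and P: "P \<in> forms n d" and j: "j \<le> n"
  shows "f j ^ d * msubst g P = g j ^ d * msubst f P"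
proof (rule mpoly_eq_iff[THEN iffD2, rule_format])
  fix x
  have eq: "point_eval (f j) x * point_eval (g i) x = point_eval (g j) x * point_eval (f i) x"
    if "i \<le> n" for i
    using arg_cong[OF proportionalD[OF fg j that], of "\<lambda>p. point_eval p x"] by (simp add: mult.commute)
  have "point_eval (f j) x ^ d * point_eval P (\<lambda>i. point_eval (g i) x)
      = point_eval P (\<lambda>i. point_eval (f j) x * point_eval (g i) x)"
    by (rule point_eval_form[OF P, symmetric]) simp
  also have "\<dots> = point_eval (g j) x ^ d * point_eval P (\<lambda>i. point_eval (f i) x)"
    by (rule point_eval_form[OF P]) (rule eq)
  finally show "point_eval (f j ^ d * msubst g P) x = point_eval (g j ^ d * msubst f P) x"
    by simp
qed

lemma msubst_proportional_eq_0:
  assumes fg: "(f, g) \<in> proportional n" and P: "P \<in> forms n d" and "msubst f P = 0"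
  shows "msubst g P = 0"
proof -
  obtain l where "l \<le> n" "f l \<noteq> 0"
    using fg by (auto simp: proportional_def hom_tuples_def)
  then show ?thesis
    using msubst_proportional[OF fg P, of l] assms(3) by simp
qed

lemma comp_tuple_in_hom_tuples:
  assumes f: "f \<in> hom_tuples n" and g: "g \<in> hom_tuples n" and "l \<le> n" "msubst g (f l) \<noteq> 0"
  shows "(\<lambda>i. msubst g (f i)) \<in> hom_tuples n"
proof -
  obtain d where d: "\<And>i. i \<le> n \<Longrightarrow> f i \<in> forms n d"
    using f by (rule hom_tuples_degreeE) blast
  obtain e where e: "\<And>i. i \<le> n \<Longrightarrow> g i \<in> forms n e"
    using g by (rule hom_tuples_degreeE) blast
  show ?thesis
    using f d e assms(3,4)
    by (intro hom_tuplesI[where d = "d * e" and l = l]) (auto simp: hom_tuples_def intro: forms_msubst)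
qed

text \<open>Two changes of representatives have to be compared: one of the outer tuple, which commutes
  with substitution, and one of the inner tuple, which multiplies all values by one factor.\<close>

lemma ratmap_comp_ratmap:
  assumes f: "f \<in> hom_tuples n" and g: "g \<in> hom_tuples n" and l: "l \<le> n" "msubst g (f l) \<noteq> 0"
  shows "ratmap_comp n (ratmap n f) (ratmap n g) = ratmap n (\<lambda>i. msubst g (f i))"
proof (intro equalityI subsetI)
  fix h assume "h \<in> ratmap n (\<lambda>i. msubst g (f i))"
  then show "h \<in> ratmap_comp n (ratmap n f) (ratmap n g)"
    using mem_ratmap[OF f] mem_ratmap[OF g] unfolding ratmap_comp_def by (blast dest: mem_ratmapD)
next
  fix h assume "h \<in> ratmap_comp n (ratmap n f) (ratmap n g)"
  then obtain f' g' where f': "(f, f') \<in> proportional n" and g': "(g, g') \<in> proportional n"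
    and h: "((\<lambda>i. msubst g' (f' i)), h) \<in> proportional n"
    unfolding ratmap_comp_def by (auto dest: mem_ratmapD)
  obtain d where d: "\<And>i. i \<le> n \<Longrightarrow> f i \<in> forms n d"
    using f by (rule hom_tuples_degreeE) blast
  obtain m where m: "m \<le> n" "g' m \<noteq> 0"
    using g' by (auto simp: proportional_def hom_tuples_def)
  have "msubst g (f i) * msubst g' (f' j) = msubst g (f j) * msubst g' (f' i)"
    if ij: "i \<le> n" "j \<le> n" for i j
  proof -
    have sub: "g' m ^ d * msubst g (f i) = g m ^ d * msubst g' (f i)" if "i \<le> n" for i
      using msubst_proportional[OF g' d m(1)] that by simp
    have comm: "msubst g' (f i) * msubst g' (f' j) = msubst g' (f j) * msubst g' (f' i)"
      using arg_cong[OF proportionalD[OF f' ij], of "msubst g'"] by simp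
    have "g' m ^ d * (msubst g (f i) * msubst g' (f' j)) = g m ^ d * (msubst g' (f i) * msubst g' (f' j))"
      by (simp only: mult.assoc[symmetric] sub[OF ij(1)])
    also have "\<dots> = g' m ^ d * (msubst g (f j) * msubst g' (f' i))"
      by (simp only: comm mult.assoc[symmetric] sub[OF ij(2)])
    finally have "g' m ^ d * (msubst g (f i) * msubst g' (f' j)) = g' m ^ d * (msubst g (f j) * msubst g' (f' i))" .
    then show ?thesis
      using m by simp
  qed
  then have "((\<lambda>i. msubst g (f i)), (\<lambda>i. msubst g' (f' i))) \<in> proportional n"
    using comp_tuple_in_hom_tuples[OF f g l] h by (auto simp: proportional_def)
  then have "((\<lambda>i. msubst g (f i)), h) \<in> proportional n"
    using h by (rule proportional_trans)
  then show "h \<in> ratmap n (\<lambda>i. msubst g (f i))"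
    by (simp add: ratmap_def)
qed

definition id_tuple :: "nat \<Rightarrow> nat \<Rightarrow> mpoly" where
  "id_tuple n = (\<lambda>i. if i \<le> n then mvar i else 0)"

lemma ratmap_id_eq: "ratmap_id n = ratmap n (id_tuple n)"
  by (simp add: ratmap_id_def id_tuple_def)

lemma mvar_neq_0 [simp]: "mvar i \<noteq> 0"
  using point.meval_mvar[of "\<lambda>_. 1" i] point.meval_zero[of "\<lambda>_. 1"] by (metis one_neq_zero)

lemma id_tuple_in_hom_tuples: "id_tuple n \<in> hom_tuples n"
  by (rule hom_tuplesI[where d = 1 and l = 0]) (auto simp: id_tuple_def simp del: One_nat_def)

text \<open>Dominance in algebraic form and for a single representative: no hypersurface contains the
  image.\<close>

definition dominating :: "nat \<Rightarrow> (nat \<Rightarrow> mpoly) \<Rightarrow> bool" where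
  "dominating n g \<longleftrightarrow> (\<forall>d. \<forall>P\<in>forms n d. msubst g P = 0 \<longrightarrow> P = 0)"

lemma dominatingD: "dominating n g \<Longrightarrow> P \<in> forms n d \<Longrightarrow> msubst g P = 0 \<Longrightarrow> P = 0"
  by (auto simp: dominating_def)

lemma dominating_proportional:
  assumes "dominating n g" "(f, g) \<in> proportional n"
  shows "dominating n f"
  using assms msubst_proportional_eq_0 unfolding dominating_def by blast

lemma dominating_id_tuple: "dominating n (id_tuple n)"
  unfolding dominating_def
proof (intro allI ballI impI)
  fix d P assume P: "P \<in> forms n d" and 0: "msubst (id_tuple n) P = 0"
  have "point_eval P x = point_eval (msubst (id_tuple n) P) x" for x
    unfolding point_eval_msubst by (rule point_eval_form_cong[OF P]) (simp add: id_tuple_def)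
  then show "P = 0"
    by (intro mpoly_zeroI) (simp only: 0 point.meval_zero)
qed

text \<open>A right inverse on the level of tuples prevents a form from vanishing on the image.\<close>

lemma dominating_if_birational:
  assumes "ratmap n f \<in> carrier (bir_group n)" and f: "f \<in> hom_tuples n"
  shows "dominating n f"
proof -
  obtain \<psi> where "ratmap_comp n (ratmap n f) \<psi> = ratmap n (id_tuple n)"
    using assms(1) by (auto simp: bir_group_def ratmap_id_eq)
  then have "id_tuple n \<in> ratmap_comp n (ratmap n f) \<psi>"
    by (simp add: id_tuple_in_hom_tuples)
  then obtain f' g where f': "(f, f') \<in> proportional n"
    and id: "((\<lambda>i. msubst g (f' i)), id_tuple n) \<in> proportional n"
    by (auto simp: ratmap_comp_def dest: mem_ratmapD)
  have "dominating n f'"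
    unfolding dominating_def
  proof (intro allI ballI impI)
    fix d P assume P: "P \<in> forms n d" and 0: "msubst f' P = 0"
    have "msubst (\<lambda>i. msubst g (f' i)) P = msubst g (msubst f' P)"
      by (simp add: mpoly_eq_iff)
    then have "msubst (id_tuple n) P = 0"
      using 0 by (intro msubst_proportional_eq_0[OF id P]) simp
    with P show "P = 0"
      by (rule dominatingD[OF dominating_id_tuple])
  qed
  then show ?thesis
    using f' by (rule dominating_proportional)
qed

lemma dominant_ratmap:
  assumes g: "g \<in> hom_tuples n" and "dominating n g"
  shows "dominant n (ratmap n g)"
  unfolding dominant_def
proof (intro allI ballI impI)
  fix d P assume P: "P \<in> forms n d"
    and *: "\<forall>f\<in>ratmap n g. \<forall>x. (\<exists>i\<le>n. point_eval (f i) x \<noteq> 0) \<longrightarrow>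
       point_eval P (\<lambda>i. point_eval (f i) x) = 0"
  obtain l where l: "l \<le> n" "g l \<noteq> 0"
    using g by (rule hom_tuples_nonzeroE)
  have "msubst g P = 0"
  proof (rule mpoly_eqI[OF l(2)])
    fix x assume "point_eval (g l) x \<noteq> 0"
    then show "point_eval (msubst g P) x = point_eval 0 x"
      using * l mem_ratmap[OF g] by auto
  qed
  with assms(2) P show "P = 0"
    by (rule dominatingD)
qed

section \<open>The function field and pullbacks\<close>

lemma function_field_simps [simp]:
  "monoid.mult (function_field n) = (*)" "one (function_field n) = 1"
  "zero (function_field n) = 0" "add (function_field n) = (+)"
  by (simp_all add: function_field_def)

lemma function_fieldI:
  "P \<in> forms n d \<Longrightarrow> Q \<in> forms n d \<Longrightarrow> Q \<noteq> 0 \<Longrightarrow>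
     Fraction_Field.Fract P Q \<in> carrier (function_field n)"
  by (auto simp: function_field_def)

lemma function_fieldE:
  assumes "z \<in> carrier (function_field n)"
  obtains P Q d where "P \<in> forms n d" "Q \<in> forms n d" "Q \<noteq> 0" "z = Fraction_Field.Fract P Q"
  using assms by (auto simp: function_field_def)

lemma function_field_closed:
  assumes "z \<in> carrier (function_field n)" "w \<in> carrier (function_field n)"
  shows "z + w \<in> carrier (function_field n)" "z * w \<in> carrier (function_field n)"
    "- z \<in> carrier (function_field n)" "inverse z \<in> carrier (function_field n)"
proof -
  obtain P Q d where z: "P \<in> forms n d" "Q \<in> forms n d" "Q \<noteq> 0" "z = Fraction_Field.Fract P Q"
    using assms(1) by (rule function_fieldE)
  obtain P' Q' e where w: "P' \<in> forms n e" "Q' \<in> forms n e" "Q' \<noteq> 0" "w = Fraction_Field.Fract P' Q'"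
    using assms(2) by (rule function_fieldE)
  have "P' * Q \<in> forms n (d + e)"
    using forms_mult[OF z(2) w(1)] by (simp add: mult.commute)
  then show "z + w \<in> carrier (function_field n)"
    using z w by (auto intro!: function_fieldI[where d = "d + e"])
  show "z * w \<in> carrier (function_field n)"
    using z w by (auto intro!: function_fieldI[where d = "d + e"])
  show "- z \<in> carrier (function_field n)"
    using z by (auto intro!: function_fieldI)
  show "inverse z \<in> carrier (function_field n)"
  proof (cases "P = 0")
    case True
    then show ?thesis
      using z function_fieldI[of 0 n 0 1] by (auto simp: fract_collapse)
  next
    case False
    then show ?thesis
      using z by (auto intro!: function_fieldI)
  qed
qed

lemma function_field_0_1:
  "0 \<in> carrier (function_field n)" "1 \<in> carrier (function_field n)"
  using function_fieldI[of 0 n 0 1] function_fieldI[of 1 n 0 1]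
  by (auto simp: fract_collapse)

lemma field_function_field: "field (function_field n)"
proof -
  interpret cring "function_field n"
  proof (rule cringI)
    show "abelian_group (function_field n)"
    proof (rule abelian_groupI)
      fix z assume "z \<in> carrier (function_field n)"
      then show "\<exists>w\<in>carrier (function_field n). w \<oplus>\<^bsub>function_field n\<^esub> z = \<zero>\<^bsub>function_field n\<^esub>"
        by (intro bexI[of _ "- z"]) (simp_all add: function_field_closed)
    qed (simp_all add: function_field_closed function_field_0_1 add_ac)
    show "comm_monoid (function_field n)"
      by (rule comm_monoidI) (simp_all add: function_field_closed function_field_0_1 mult_ac)
  qed (simp add: distrib_right)
  show ?thesis
  proof (rule cring_fieldI)
    show "Units (function_field n) = carrier (function_field n) - {\<zero>\<^bsub>function_field n\<^esub>}"
    proof (intro equalityI subsetI)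
      fix z assume "z \<in> Units (function_field n)"
      then show "z \<in> carrier (function_field n) - {\<zero>\<^bsub>function_field n\<^esub>}"
        by (auto simp: Units_def)
    next
      fix z assume z: "z \<in> carrier (function_field n) - {\<zero>\<^bsub>function_field n\<^esub>}"
      then have "inverse z * z = 1" "z * inverse z = 1"
        by simp_all
      with z show "z \<in> Units (function_field n)"
        unfolding Units_def using function_field_closed(4)[of z n z]
        by (simp del: left_inverse right_inverse) blast
    qed
  qed
qed

text \<open>The value does not depend on the choices because a dominating tuple gives nonzero
  denominators, and a proportional tuple multiplies numerator and denominator alike.\<close>

lemma pullback_Fract:
  assumes g: "g \<in> hom_tuples n" and dom: "dominating n g"
    and P: "P \<in> forms n d" and Q: "Q \<in> forms n d" "Q \<noteq> 0"
  shows "pullback n (ratmap n g) (Fraction_Field.Fract P Q)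
      = Fraction_Field.Fract (msubst g P) (msubst g Q)"
  unfolding pullback_def
proof (rule the_equality)
  show "\<exists>h\<in>ratmap n g. \<exists>d. \<exists>P'\<in>forms n d. \<exists>Q'\<in>forms n d. Q' \<noteq> 0 \<and>
     Fraction_Field.Fract P Q = Fraction_Field.Fract P' Q' \<and>
     Fraction_Field.Fract (msubst g P) (msubst g Q) = Fraction_Field.Fract (msubst h P') (msubst h Q')"
    using assms by (auto intro!: bexI[where x = g])
next
  fix w
  assume "\<exists>h\<in>ratmap n g. \<exists>d. \<exists>P'\<in>forms n d. \<exists>Q'\<in>forms n d. Q' \<noteq> 0 \<and>
     Fraction_Field.Fract P Q = Fraction_Field.Fract P' Q' \<and>
     w = Fraction_Field.Fract (msubst h P') (msubst h Q')"
  then obtain h e P' Q' where h: "(g, h) \<in> proportional n"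
    and P': "P' \<in> forms n e" and Q': "Q' \<in> forms n e" "Q' \<noteq> 0"
    and eq: "Fraction_Field.Fract P Q = Fraction_Field.Fract P' Q'"
    and w: "w = Fraction_Field.Fract (msubst h P') (msubst h Q')"
    by (auto dest!: mem_ratmapD)
  have nz: "msubst g Q \<noteq> 0" "msubst g Q' \<noteq> 0" "msubst h Q' \<noteq> 0"
    using Q Q' dom dominating_proportional[OF dom proportional_sym[OF h]] by (auto dest: dominatingD)
  obtain l where l: "l \<le> n" "g l \<noteq> 0"
    using g by (rule hom_tuples_nonzeroE)
  have "P * Q' = P' * Q"
    using eq Q Q' by (simp add: eq_fract)
  then have "msubst g P * msubst g Q' = msubst g P' * msubst g Q"
    by (metis subst.meval_mult)
  moreover have "msubst h P' * msubst g Q' = msubst g P' * msubst h Q'"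
  proof -
    have "g l ^ e * (msubst h P' * msubst g Q') = (g l ^ e * msubst h P') * msubst g Q'"
      by simp
    also have "\<dots> = msubst g P' * (h l ^ e * msubst g Q')"
      using msubst_proportional[OF h P' l(1)] by simp
    also have "\<dots> = g l ^ e * (msubst g P' * msubst h Q')"
      using msubst_proportional[OF h Q'(1) l(1)] by simp
    finally show ?thesis
      using l by simp
  qed
  ultimately have "Fraction_Field.Fract (msubst g P) (msubst g Q) = Fraction_Field.Fract (msubst g P') (msubst g Q')"
    "Fraction_Field.Fract (msubst h P') (msubst h Q') = Fraction_Field.Fract (msubst g P') (msubst g Q')"
    using nz by (simp_all add: eq_fract(1))
  then show "w = Fraction_Field.Fract (msubst g P) (msubst g Q)"
    by (simp add: w)
qed

lemma pullback_ring_hom: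
  assumes g: "g \<in> hom_tuples n" and dom: "dominating n g"
  shows "pullback n (ratmap n g) \<in> ring_hom (function_field n) (function_field n)"
proof (rule ring_hom_memI)
  note pb = pullback_Fract[OF g dom]
  obtain e where e: "\<And>i. i \<le> n \<Longrightarrow> g i \<in> forms n e"
    using g by (rule hom_tuples_degreeE) blast
  fix z assume "z \<in> carrier (function_field n)"
  then obtain P Q d where z: "P \<in> forms n d" "Q \<in> forms n d" "Q \<noteq> 0" "z = Fraction_Field.Fract P Q"
    by (rule function_fieldE)
  have nz: "msubst g Q \<noteq> 0"
    using z dom by (auto dest: dominatingD)
  show "pullback n (ratmap n g) z \<in> carrier (function_field n)"
    using z nz e by (auto simp: pb intro!: function_fieldI[where d = "d * e"] forms_msubst)
  fix w assume "w \<in> carrier (function_field n)"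
  then obtain P' Q' d' where w: "P' \<in> forms n d'" "Q' \<in> forms n d'" "Q' \<noteq> 0" "w = Fraction_Field.Fract P' Q'"
    by (rule function_fieldE)
  have nz': "msubst g Q' \<noteq> 0"
    using w dom by (auto dest: dominatingD)
  have forms: "P * P' \<in> forms n (d + d')" "Q * Q' \<in> forms n (d + d')" "P * Q' + P' * Q \<in> forms n (d + d')"
    using forms_mult[OF z(1) w(1)] forms_mult[OF z(2) w(2)] forms_mult[OF z(1) w(2)]
      forms_mult[OF w(1) z(2)] by (simp_all add: forms_add add.commute[of d'])
  show "pullback n (ratmap n g) (z \<otimes>\<^bsub>function_field n\<^esub> w) =
      pullback n (ratmap n g) z \<otimes>\<^bsub>function_field n\<^esub> pullback n (ratmap n g) w"
    using z w forms by (simp add: pb)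
  show "pullback n (ratmap n g) (z \<oplus>\<^bsub>function_field n\<^esub> w) =
      pullback n (ratmap n g) z \<oplus>\<^bsub>function_field n\<^esub> pullback n (ratmap n g) w"
    using z w forms nz nz' by (simp add: pb)
next
  show "pullback n (ratmap n g) \<one>\<^bsub>function_field n\<^esub> = \<one>\<^bsub>function_field n\<^esub>"
    using pullback_Fract[OF g dom forms_one forms_one] by (simp add: fract_collapse)
qed

lemma subfield_pullback:
  assumes "g \<in> hom_tuples n" "dominating n g"
  shows "subfield (pullback n (ratmap n g) ` carrier (function_field n)) (function_field n)"
proof -
  interpret field "function_field n"
    by (rule field_function_field)
  have "ring_hom_ring (function_field n) (function_field n) (pullback n (ratmap n g))"
    using pullback_ring_hom[OF assms] by (intro ring_hom_ringI2 is_ring)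
  then show ?thesis
    by (rule ring_hom_ring.img_is_subfield(2)[OF _ carrier_is_subfield]) simp
qed

section \<open>Galois extensions from finite sets of automorphisms\<close>

context field
begin

definition root_product :: "'a set \<Rightarrow> 'a list" where
  "root_product S = finprod (poly_ring R) (\<lambda>b. [\<one>, \<ominus> b]) S"

lemma linear_in_poly_ring: "b \<in> carrier R \<Longrightarrow> [\<one>, \<ominus> b] \<in> carrier (poly_ring R)"
  by (simp add: polynomial_def flip: univ_poly_carrier)

lemma root_product_insert:
  assumes "finite S" "S \<subseteq> carrier R" "b \<in> carrier R" "b \<notin> S"
  shows "root_product (insert b S) = [\<one>, \<ominus> b] \<otimes>\<^bsub>poly_ring R\<^esub> root_product S"
proof -
  interpret UP: cring "poly_ring R"
    by (rule univ_poly_is_cring[OF carrier_is_subring])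
  show ?thesis
    unfolding root_product_def using assms
    by (intro UP.finprod_insert) (auto simp: linear_in_poly_ring)
qed

lemma root_product_empty: "root_product {} = [\<one>]"
proof -
  interpret UP: cring "poly_ring R"
    by (rule univ_poly_is_cring[OF carrier_is_subring])
  show ?thesis
    using UP.finprod_empty by (simp add: root_product_def univ_poly_one)
qed

lemma root_product:
  assumes "finite S" "S \<subseteq> carrier R"
  shows "root_product S \<in> carrier (poly_ring R) \<and> root_product S \<noteq> [] \<and>
    roots (root_product S) = mset_set S \<and> degree (root_product S) = card S"
  using assms
proof (induction S rule: finite_induct)
  case empty
  have "[\<one>] \<in> carrier (poly_ring R)"
    by (simp add: polynomial_def flip: univ_poly_carrier)
  then show ?case
    using degree_zero_imp_empty_roots[of "[\<one>]"] by (simp add: root_product_empty)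
next
  case (insert b S)
  let ?l = "[\<one>, \<ominus> b]" and ?p = "root_product S"
  interpret UP: domain "poly_ring R"
    by (rule univ_poly_is_domain[OF carrier_is_subring])
  have b: "b \<in> carrier R" and S: "S \<subseteq> carrier R"
    using insert.prems by auto
  note IH = insert.IH[OF S]
  have eq: "root_product (insert b S) = ?l \<otimes>\<^bsub>poly_ring R\<^esub> ?p"
    using insert.hyps b S by (intro root_product_insert)
  have l: "?l \<in> carrier (poly_ring R)"
    using b by (rule linear_in_poly_ring)
  have p: "?p \<in> carrier (poly_ring R)" "?p \<noteq> []"
    using IH by auto
  have "degree (?l \<otimes>\<^bsub>poly_ring R\<^esub> ?p) = Suc (card S)"
    using poly_mult_degree_eq[OF carrier_is_subring, of ?l ?p] l p IH
    by (cases ?p) (simp_all add: univ_poly_mult univ_poly_carrier del: poly_mult.simps)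
  moreover have "roots (?l \<otimes>\<^bsub>poly_ring R\<^esub> ?p) = add_mset b (roots ?p)"
    using b p by (rule poly_mult_degree_one_monic_imp_same_roots)
  moreover have "?l \<otimes>\<^bsub>poly_ring R\<^esub> ?p \<noteq> []"
    using UP.integral[OF _ l p(1)] p(2) by (auto simp: univ_poly_zero)
  ultimately show ?case
    using insert.hyps IH l p by (simp add: eq)
qed

lemma map_root_product:
  assumes h: "h \<in> ring_hom R R" and "finite S" "S \<subseteq> carrier R"
  shows "map h (root_product S) = root_product (h ` S)"
  using assms(2,3)
proof (induction S rule: finite_induct)
  case empty
  then show ?case
    using ring_hom_one[OF h] by (simp add: root_product_empty)
next
  case (insert b S)
  interpret h: ring_hom_ring R R h
    using h by (intro ring_hom_ringI2 is_ring)
  have inj: "inj_on h (carrier R)"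
    using h.img_is_subfield(1)[OF carrier_is_subfield] by simp
  have b: "b \<in> carrier R" and S: "S \<subseteq> carrier R"
    using insert.prems by auto
  have hb: "h b \<in> carrier R" "h b \<notin> h ` S" "h ` S \<subseteq> carrier R"
    using b S insert.hyps inj by (auto simp: inj_on_image_mem_iff[OF inj])
  let ?l = "[\<one>, \<ominus> b]" and ?p = "root_product S"
  have l: "?l \<in> carrier (poly_ring R)"
    using b by (rule linear_in_poly_ring)
  have p: "?p \<in> carrier (poly_ring R)"
    using root_product[OF insert.hyps(1) S] by blast
  have eq: "root_product (insert b S) = poly_mult ?l ?p"
    using insert.hyps b S by (simp add: root_product_insert univ_poly_mult)
  \<comment> \<open>By injectivity the leading coefficient stays nonzero.\<close>
  have norm: "normalize (map h q) = map h q" if "q \<in> carrier (poly_ring R)" for q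
  proof (cases q)
    case (Cons a as)
    then have "a \<in> carrier R" "a \<noteq> \<zero>"
      using that by (auto simp: polynomial_def simp flip: univ_poly_carrier)
    then have "h a \<noteq> \<zero>"
      using inj h.hom_zero by (metis inj_onD zero_closed)
    then show ?thesis
      using Cons by simp
  qed simp
  have "map h (root_product (insert b S)) = normalize (map h (poly_mult ?l ?p))"
    using norm root_product[of "insert b S"] insert.hyps insert.prems by (simp add: eq)
  also have "\<dots> = poly_mult (map h ?l) (map h ?p)"
    using l p by (intro h.poly_mult_hom') (auto simp: polynomial_def simp flip: univ_poly_carrier)
  also have "\<dots> = root_product (insert (h b) (h ` S))"
    using insert.IH[OF S] hb insert.hyps b ring_hom_one[OF h]
    by (simp add: root_product_insert univ_poly_mult)
  finally show ?case
    by simp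
qed

text \<open>The idea of Artin's theorem: the orbit of \<open>a\<close> under the given endomorphisms is permuted by
  them, so the monic polynomial with the orbit as its simple roots has coefficients in \<open>K\<close>. It
  is divisible by the minimal polynomial of \<open>a\<close>, which therefore splits with simple roots.\<close>

theorem galois_over_fixed_field:
  assumes K: "subfield K R" and fin: "finite G"
    and hom: "\<And>s. s \<in> G \<Longrightarrow> s \<in> ring_hom R R"
    and id: "\<exists>e\<in>G. \<forall>a\<in>carrier R. e a = a"
    and comp: "\<And>s t. s \<in> G \<Longrightarrow> t \<in> G \<Longrightarrow> \<exists>u\<in>G. \<forall>a\<in>carrier R. s (t a) = u a"
    and fixed: "\<And>a. a \<in> carrier R \<Longrightarrow> (\<And>s. s \<in> G \<Longrightarrow> s a = a) \<Longrightarrow> a \<in> K"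
  shows "galois_over K"
  unfolding galois_over_def
proof (intro conjI ballI allI K)
  fix a assume a: "a \<in> carrier R"
  define S where "S = (\<lambda>s. s a) ` G"
  define p where "p = root_product S"
  have S: "finite S" "S \<subseteq> carrier R"
    using fin a by (auto simp: S_def intro: ring_hom_closed[OF hom])
  note rp = root_product[OF S]
  have inv: "s ` S = S" if s: "s \<in> G" for s
  proof -
    interpret s: ring_hom_ring R R s
      using hom[OF s] by (intro ring_hom_ringI2 is_ring)
    have "inj_on s S"
      using s.img_is_subfield(1)[OF carrier_is_subfield] S(2) by (auto intro: inj_on_subset)
    moreover have "s ` S \<subseteq> S"
      using comp[OF s] a by (fastforce simp: S_def)
    ultimately show ?thesis
      using S(1) by (metis endo_inj_surj)
  qed
  have aS: "a \<in> S"
    using id a unfolding S_def by (metis image_eqI)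
  have "set p \<subseteq> K"
  proof
    fix c assume c: "c \<in> set p"
    show "c \<in> K"
    proof (rule fixed)
      show "c \<in> carrier R"
        using rp c by (auto simp: p_def polynomial_def simp flip: univ_poly_carrier)
      fix s assume s: "s \<in> G"
      have "map s p = p"
        using map_root_product[OF hom[OF s] S] inv[OF s] by (simp add: p_def)
      then show "s c = c"
        using c by (metis in_set_conv_nth length_map nth_map)
    qed
  qed
  then have pK: "p \<in> carrier (K[X])"
    using rp by (auto simp: p_def polynomial_def simp flip: univ_poly_carrier)
  have root: "eval p a = \<zero>"
    using rp S aS roots_mem_iff_is_root[of p a] by (simp add: p_def is_root_def)
  show alg: "(algebraic over K) a"
    using pK rp root by (intro algebraicI[of p]) (auto simp: p_def)
  have div: "Irr K a pdivides p"
    by (rule Irr_minimal[OF K a alg pK root])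
  have irr: "Irr K a \<in> carrier (poly_ring R)"
    using IrrE(1)[OF K a alg] by (rule carrier_polynomial_shell[OF subfieldE(1)[OF K]])
  have p: "p \<in> carrier (poly_ring R)" "p \<noteq> []" "splitted p"
    using rp by (simp_all add: splitted_def p_def)
  show "splitted (Irr K a)"
    using irr p div by (rule pdivides_imp_splitted)
  have "roots (Irr K a) \<subseteq># roots p"
    using irr p(1,2) div by (rule pdivides_imp_roots_incl)
  then have "roots (Irr K a) \<subseteq># mset_set S"
    using rp by (simp add: p_def)
  then show "count (roots (Irr K a)) b \<le> 1" for b
    using S(1) mset_subset_eq_count[of "roots (Irr K a)" "mset_set S" b]
    by (cases "b \<in> S") auto
qed

end

section \<open>Divisibility by variables and partial derivatives\<close>

text \<open>The monomials without \<open>x\<^sub>i\<close> form the remainder of division by \<open>x\<^sub>i\<close>; it has the same values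
  as the polynomial on the hyperplane \<open>x\<^sub>i = 0\<close> and does not depend on \<open>x\<^sub>i\<close>.\<close>

lemma mvar_dvd_iff: "mvar i dvd p \<longleftrightarrow> msubst (mvar(i := 0)) p = 0"
proof
  assume "mvar i dvd p"
  then show "msubst (mvar(i := 0)) p = 0"
    by (auto elim!: dvdE)
next
  assume 0: "msubst (mvar(i := 0)) p = 0"
  let ?s = "\<lambda>m. Poly_Mapping.single m (Poly_Mapping.lookup p m)"
  let ?I = "{m \<in> Poly_Mapping.keys p. Poly_Mapping.lookup m i = 0}"
  define q where "q = (\<Sum>m\<in>Poly_Mapping.keys p - ?I.
    Poly_Mapping.single (m - Poly_Mapping.single i 1) (Poly_Mapping.lookup p m))"
  define r where "r = sum ?s ?I"
  have "mvar i * q = sum ?s (Poly_Mapping.keys p - ?I)"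
    unfolding q_def mvar_def sum_distrib_left mult_single
  proof (rule sum.cong[OF refl])
    fix m assume "m \<in> Poly_Mapping.keys p - ?I"
    then have "Poly_Mapping.single i 1 + (m - Poly_Mapping.single i 1) = m"
      by (intro poly_mapping_eqI) (auto simp: lookup_add lookup_minus lookup_single when_def)
    then show "Poly_Mapping.single (Poly_Mapping.single i 1 + (m - Poly_Mapping.single i 1))
        (1 * Poly_Mapping.lookup p m) = ?s m"
      by simp
  qed
  moreover have "p = sum ?s (Poly_Mapping.keys p - ?I) + r"
    unfolding r_def by (subst (1) mpoly_sum_monomials) (rule sum.subset_diff, auto)
  ultimately have p: "p = mvar i * q + r"
    by simp
  have "point_eval r x = 0" for x
  proof -
    have "monomial_eval (x(i := 0)) m = monomial_eval x m" if "m \<in> ?I" for m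
      using that by (intro monomial_eval_cong) (auto simp: in_keys_iff)
    then have "point_eval r x = point_eval r (x(i := 0))"
      by (simp add: r_def)
    also have "\<dots> = point_eval p (x(i := 0))"
      by (simp add: p)
    also have "\<dots> = point_eval (msubst (mvar(i := 0)) p) x"
      unfolding point_eval_msubst by (rule arg_cong[of _ _ "point_eval p"]) auto
    also have "\<dots> = 0"
      unfolding 0 by simp
    finally show ?thesis .
  qed
  then have "r = 0"
    by (rule mpoly_zeroI)
  with p show "mvar i dvd p"
    by simp
qed

lemma prime_elem_mvar: "prime_elem (mvar i)"
  by (rule prime_elemI) (auto simp: mvar_dvd_iff)

lemma mvar_dvd_mvar_power_iff: "mvar i dvd mvar j ^ e \<longleftrightarrow> i = j \<and> e > 0"
  by (auto simp: mvar_dvd_iff)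

lemma dvd_cancel_prime_power:
  assumes p: "prime_elem (p :: 'a::idom)" and "\<not> p dvd h" and "h dvd p ^ e * m"
  shows "h dvd m"
  using assms(3)
proof (induction e)
  case (Suc e)
  then obtain q where q: "p ^ Suc e * m = h * q"
    by (auto elim: dvdE)
  then have "p dvd h * q"
    by (metis dvd_triv_left mult.assoc power_Suc)
  then have "p dvd q"
    using prime_elem_dvd_multD[OF p] assms(2) by blast
  then obtain q' where "q = p * q'"
    by (rule dvdE)
  with q have "p * (p ^ e * m) = p * (h * q')"
    by (simp add: mult_ac)
  then have "p ^ e * m = h * q'"
    using prime_elem_not_zeroI[OF p] by simp
  then show ?case
    using Suc.IH by simp
qed simp

lemma mpderiv_superset:
  assumes "finite I" "Poly_Mapping.keys p \<subseteq> I"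
  shows "mpderiv i p = (\<Sum>m\<in>I. Poly_Mapping.single (m - Poly_Mapping.single i 1)
       (of_nat (Poly_Mapping.lookup m i) * Poly_Mapping.lookup p m))"
  unfolding mpderiv_def using assms
  by (intro sum.mono_neutral_left) (auto simp: in_keys_iff)

lemma mpderiv_add: "mpderiv i (p + q) = mpderiv i p + mpderiv i q"
proof -
  let ?I = "Poly_Mapping.keys p \<union> Poly_Mapping.keys q"
  have "mpderiv i (p + q) = (\<Sum>m\<in>?I. Poly_Mapping.single (m - Poly_Mapping.single i 1)
       (of_nat (Poly_Mapping.lookup m i) * Poly_Mapping.lookup (p + q) m))"
    by (intro mpderiv_superset keys_add) auto
  also have "\<dots> = mpderiv i p + mpderiv i q"
    by (simp add: mpderiv_superset[of ?I p] mpderiv_superset[of ?I q] lookup_add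
        distrib_left single_add sum.distrib)
  finally show ?thesis .
qed

lemma mpderiv_zero [simp]: "mpderiv i 0 = 0"
  by (simp add: mpderiv_def)

lemma mpderiv_uminus: "mpderiv i (- p) = - mpderiv i p"
  using mpderiv_add[of i p "- p"] by (simp add: eq_neg_iff_add_eq_0 add.commute)

lemma mpderiv_sum: "mpderiv i (\<Sum>j\<in>J. f j) = (\<Sum>j\<in>J. mpderiv i (f j))"
  by (induction J rule: infinite_finite_induct) (auto simp: mpderiv_add)

lemma mpderiv_single: "mpderiv i (Poly_Mapping.single m c) =
    Poly_Mapping.single (m - Poly_Mapping.single i 1) (of_nat (Poly_Mapping.lookup m i) * c)"
  by (cases "c = 0") (auto simp: mpderiv_def)

lemma mvar_power: "mvar j ^ e = Poly_Mapping.single (Poly_Mapping.single j e) 1"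
  by (induction e) (auto simp: mvar_def mult_single simp flip: single_add)

lemma mpderiv_mvar_power:
  "mpderiv i (mvar j ^ Suc e) = (if i = j then of_nat (Suc e) * mvar j ^ e else 0)"
proof -
  have "(of_nat (Suc e) :: mpoly) = mconst (of_nat (Suc e))"
    by (metis single_of_nat)
  moreover have "Poly_Mapping.single j (Suc e) - Poly_Mapping.single j 1 = Poly_Mapping.single j e"
    by (simp flip: single_diff)
  ultimately show ?thesis
    by (auto simp: mvar_power mpderiv_single mult_single lookup_single simp del: power_Suc)
qed

lemma mpderiv_mvar_mult_power:
  assumes "j \<noteq> 0" "i \<noteq> j"
  shows "mpderiv i (mvar 0 * mvar j ^ e) = (if i = 0 then mvar j ^ e else 0)"
proof -
  have "mvar 0 * mvar j ^ e = Poly_Mapping.single (Poly_Mapping.single 0 1 + Poly_Mapping.single j e) 1"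
    by (simp only: mvar_power) (simp add: mvar_def mult_single)
  then show ?thesis
    using assms by (simp add: mpderiv_single lookup_add lookup_single mvar_power)
qed

section \<open>The foliation with first integral the Fermat polynomial\<close>

text \<open>The coefficients \<open>\<zeta>\<close> are carried along because the deck transformations involve the
  Fermat polynomial in twisted coordinates.\<close>

definition fermat :: "nat \<Rightarrow> nat \<Rightarrow> (nat \<Rightarrow> complex) \<Rightarrow> mpoly" where
  "fermat n k \<zeta> = (\<Sum>i=1..n. mconst (\<zeta> i) * mvar i ^ (k + 1))"

text \<open>These are the coefficients of \<open>x\<^sub>0\<^sup>k\<^sup>+\<^sup>2 d(F / x\<^sub>0\<^sup>k\<^sup>+\<^sup>1)\<close>, divided by \<open>k + 1\<close>.\<close>

definition fermat_form :: "nat \<Rightarrow> nat \<Rightarrow> nat \<Rightarrow> mpoly" where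
  "fermat_form n k i = (if i = 0 then - fermat n k (\<lambda>_. 1)
     else if i \<le> n then mvar 0 * mvar i ^ k else 0)"

lemma fermat_one: "fermat n k (\<lambda>_. 1) = (\<Sum>i=1..n. mvar i ^ (k + 1))"
  by (simp add: fermat_def)

lemma point_eval_fermat [simp]:
  "point_eval (fermat n k \<zeta>) x = (\<Sum>i=1..n. \<zeta> i * x i ^ (k + 1))"
  by (simp add: fermat_def)

lemma fermat_in_forms: "fermat n k \<zeta> \<in> forms n (k + 1)"
proof -
  have "mconst (\<zeta> i) * mvar i ^ (k + 1) \<in> forms n (0 + (k + 1) * 1)" if "i \<in> {1..n}" for i
    using that by (intro forms_mult forms_power forms_const forms_mvar) auto
  then show ?thesis
    unfolding fermat_def by (intro forms_sum) auto
qed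

lemma fermat_neq_0:
  assumes "n \<ge> 1" "\<zeta> n \<noteq> 0"
  shows "fermat n k \<zeta> \<noteq> 0"
proof
  assume "fermat n k \<zeta> = 0"
  then have "point_eval (fermat n k \<zeta>) (\<lambda>i. if i = n then 1 else 0) = 0"
    by simp
  moreover have "point_eval (fermat n k \<zeta>) (\<lambda>i. if i = n then 1 else 0) =
      (\<Sum>i=1..n. if i = n then \<zeta> i else 0)"
    unfolding point_eval_fermat by (intro sum.cong) auto
  ultimately show False
    using assms by simp
qed

lemma not_mvar_0_dvd_fermat:
  assumes "n \<ge> 1"
  shows "\<not> mvar 0 dvd fermat n k (\<lambda>_. 1)"
proof -
  have "msubst (mvar(0 := 0)) (fermat n k (\<lambda>_. 1)) = fermat n k (\<lambda>_. 1)"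
    by (simp add: mpoly_eq_iff fermat_def)
  then show ?thesis
    using fermat_neq_0[OF assms, of "\<lambda>_. 1" k] by (simp add: mvar_dvd_iff)
qed

lemma mpderiv_fermat:
  "mpderiv i (fermat n k (\<lambda>_. 1)) = (if i \<in> {1..n} then of_nat (k + 1) * mvar i ^ k else 0)"
  by (simp add: fermat_one mpderiv_sum mpderiv_mvar_power del: power_Suc of_nat_Suc)

lemma point_eval_fermat_form:
  "point_eval (fermat_form n k i) x = (if i = 0 then - (\<Sum>i=1..n. x i ^ (k + 1))
     else if i \<le> n then x 0 * x i ^ k else 0)"
  by (simp add: fermat_form_def)

lemma fermat_form_in_forms: "fermat_form n k i \<in> forms n (k + 1)"
proof -
  have "mvar 0 * mvar i ^ k \<in> forms n (1 + k * 1)" if "i \<le> n"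
    using that by (intro forms_mult forms_power forms_mvar) auto
  then show ?thesis
    using fermat_in_forms by (auto simp: fermat_form_def)
qed

lemma fermat_form_neq_0:
  assumes "n \<ge> 1" "i \<le> n"
  shows "fermat_form n k i \<noteq> 0"
  using assms fermat_neq_0[of n "\<lambda>_. 1" k] by (auto simp: fermat_form_def)

lemma fermat_form_in_hom_tuples:
  assumes "n \<ge> 1"
  shows "fermat_form n k \<in> hom_tuples n"
  using fermat_form_neq_0[OF assms, of 0 k]
  by (intro hom_tuplesI[where d = "k + 1" and l = 0] fermat_form_in_forms)
     (auto simp: fermat_form_def)

lemma codim1_foliation_fermat_form:
  assumes n: "n \<ge> 2"
  shows "codim1_foliation n (fermat_form n k)"
  unfolding codim1_foliation_def
proof (intro conjI allI impI)
  let ?w = "fermat_form n k"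
  show "?w \<in> hom_tuples n"
    using n by (intro fermat_form_in_hom_tuples) simp
  have split: "(\<Sum>i\<le>n. f i) = f 0 + (\<Sum>i=1..n. f i)" for f :: "nat \<Rightarrow> mpoly"
    by (metis One_nat_def sum.atMost_shift sum.shift_bounds_Suc_ivl sum.atLeast1_atMost_eq)
  have "(\<Sum>i=1..n. mvar i * ?w i) = (\<Sum>i=1..n. mvar 0 * mvar i ^ (k + 1))"
    by (intro sum.cong) (auto simp: fermat_form_def)
  then show "(\<Sum>i\<le>n. mvar i * ?w i) = 0"
    unfolding split by (simp add: fermat_form_def fermat_one sum_distrib_left)
  define D where "D i j = mpderiv i (?w j) - mpderiv j (?w i)" for i j
  \<comment> \<open>In \<open>d\<omega>\<close> only the terms \<open>dx\<^sub>0 \<and> dx\<^sub>j\<close> survive, and their coefficients are proportional to \<open>\<omega>\<^sub>j\<close>.\<close>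
  define c where "c = (of_nat (k + 2) :: mpoly)"
  have D_0: "D 0 j = c * mvar j ^ k" if "1 \<le> j" "j \<le> n" for j
    using that mpderiv_mvar_mult_power[of j 0 k]
    by (simp add: D_def c_def fermat_form_def mpderiv_uminus mpderiv_fermat algebra_simps)
  have D_antisym: "D j i = - D i j" for i j
    by (simp add: D_def)
  have D_pos: "D i j = 0" if "1 \<le> i" "i \<le> n" "1 \<le> j" "j \<le> n" for i j
    using that mpderiv_mvar_mult_power[of j i k] mpderiv_mvar_mult_power[of i j k]
    by (cases "i = j") (auto simp: D_def fermat_form_def)
  fix i j l assume ij: "i \<le> n" "j \<le> n" "l \<le> n"
  have D_00: "D 0 0 = 0"
    by (simp add: D_def)
  have "?w i * D j l + ?w j * D l i + ?w l * D i j = 0"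
    using ij D_0[of i] D_0[of j] D_0[of l] D_antisym[of i 0] D_antisym[of j 0] D_antisym[of l 0]
      D_pos[of i j] D_pos[of j l] D_pos[of l i] D_00
    by (cases "i = 0"; cases "j = 0"; cases "l = 0") (auto simp: fermat_form_def algebra_simps)
  then show "?w i * (mpderiv j (?w l) - mpderiv l (?w j)) + ?w j * (mpderiv l (?w i) - mpderiv i (?w l)) +
      ?w l * (mpderiv i (?w j) - mpderiv j (?w i)) = 0"
    by (simp add: D_def)
next
  fix h assume h: "\<forall>i\<le>n. h dvd fermat_form n k i"
  have F: "h dvd fermat n k (\<lambda>_. 1)"
    using h by (force simp: fermat_form_def)
  have x: "h dvd mvar 0 ^ 1 * mvar i ^ k" if "1 \<le> i" "i \<le> n" for i
    using h that by (force simp: fermat_form_def)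
  \<comment> \<open>As \<open>x\<^sub>0\<close> does not divide \<open>F\<close>, a common factor divides both \<open>x\<^sub>1\<^sup>k\<close> and \<open>x\<^sub>2\<^sup>k\<close>.\<close>
  have nd: "\<not> mvar 0 dvd h"
    using F not_mvar_0_dvd_fermat[of n k] n by (auto intro: dvd_trans)
  have xk: "h dvd mvar i ^ k" if "1 \<le> i" "i \<le> n" for i
    by (rule dvd_cancel_prime_power[OF prime_elem_mvar nd x[OF that]])
  have nd1: "\<not> mvar 1 dvd h"
  proof
    assume "mvar 1 dvd h"
    then have "mvar 1 dvd mvar 2 ^ k"
      using xk[of 2] n by (auto intro: dvd_trans)
    then show False
      by (simp add: mvar_dvd_mvar_power_iff)
  qed
  have "h dvd mvar 1 ^ k * 1"
    using xk[of 1] n by simp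
  then show "h dvd 1"
    by (rule dvd_cancel_prime_power[OF prime_elem_mvar nd1])
qed

lemma point_eval_dehom: "point_eval (dehom p) x = point_eval p (\<lambda>i. if i = 0 then 1 else x i)"
  unfolding dehom_def point_eval_msubst by (rule arg_cong[of _ _ "point_eval p"]) auto

lemma first_integral_fermat_form:
  assumes n: "n \<ge> 1"
  shows "polynomial_first_integral n (fermat_form n k) (fermat n k (\<lambda>_. 1))"
  unfolding polynomial_first_integral_def
proof (intro conjI ballI)
  fix m assume m: "m \<in> Poly_Mapping.keys (fermat n k (\<lambda>_. 1))"
  have "Poly_Mapping.keys (fermat n k (\<lambda>_. 1)) \<subseteq>
      (\<Union>i\<in>{1..n}. Poly_Mapping.keys (mvar i ^ (k + 1)))"
    unfolding fermat_one by (rule keys_sum)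
  with m show "Poly_Mapping.keys m \<subseteq> {1..n}"
    by (fastforce simp: mvar_power simp del: power_Suc)
next
  have "(of_nat (k + 1) :: mpoly) \<noteq> 0"
    by (simp only: of_nat_eq_0_iff)
  then show "\<exists>i\<in>{1..n}. mpderiv i (fermat n k (\<lambda>_. 1)) \<noteq> 0"
    using n by (intro bexI[of _ 1]) (auto simp: mpderiv_fermat simp del: of_nat_Suc of_nat_add)
next
  fix i j assume "i \<in> {1..n}" "j \<in> {1..n}"
  then show "dehom (fermat_form n k i) * mpderiv j (fermat n k (\<lambda>_. 1)) =
      dehom (fermat_form n k j) * mpderiv i (fermat n k (\<lambda>_. 1))"
    by (simp add: mpderiv_fermat dehom_def fermat_form_def)
qed

text \<open>The first integral determines the ratios of \<open>\<omega>\<^sub>1, \<dots>, \<omega>\<^sub>n\<close>, and the contraction with the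
  radial vector field determines \<open>\<omega>\<^sub>0\<close> from them.\<close>

lemma proportional_fermat_form:
  assumes n: "n \<ge> 1" and w: "codim1_foliation n w"
    and int: "polynomial_first_integral n w (fermat n k (\<lambda>_. 1))"
  shows "(w, fermat_form n k) \<in> proportional n"
proof -
  let ?F = "fermat n k (\<lambda>_. 1)"
  have hom: "w \<in> hom_tuples n" and radial: "(\<Sum>i\<le>n. mvar i * w i) = 0"
    using w by (auto simp: codim1_foliation_def)
  obtain d where d: "\<And>i. i \<le> n \<Longrightarrow> w i \<in> forms n d"
    using hom by (rule hom_tuples_degreeE) blast
  have ratio: "w i * mvar j ^ k = w j * mvar i ^ k" if ij: "i \<in> {1..n}" "j \<in> {1..n}" for i j
  proof (rule mpoly_eqI[of "mvar 0"])
    fix x :: "nat \<Rightarrow> complex" assume "point_eval (mvar 0) x \<noteq> 0"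
    then have x0: "x 0 \<noteq> 0"
      by simp
    define y where "y i = x i / x 0" for i
    define y1 where "y1 = (\<lambda>i. if i = 0 then 1 else y i)"
    have wx: "point_eval (w i) x = x 0 ^ d * point_eval (w i) y1" if "i \<le> n" for i
      using x0 by (intro point_eval_form[OF d[OF that]]) (simp add: y1_def y_def)
    have "dehom (w i) * mpderiv j ?F = dehom (w j) * mpderiv i ?F"
      using int ij by (simp add: polynomial_first_integral_def)
    then have "(of_nat (k + 1) :: mpoly) * (dehom (w i) * mvar j ^ k) = of_nat (k + 1) * (dehom (w j) * mvar i ^ k)"
      using ij by (simp add: mpderiv_fermat mult.left_commute del: of_nat_add of_nat_Suc)
    then have "dehom (w i) * mvar j ^ k = dehom (w j) * mvar i ^ k"
      by (subst (asm) mult_cancel_left) (simp only: of_nat_eq_0_iff, simp)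
    then have "point_eval (dehom (w i) * mvar j ^ k) y = point_eval (dehom (w j) * mvar i ^ k) y"
      by (simp only:)
    then have "point_eval (w i) y1 * y j ^ k = point_eval (w j) y1 * y i ^ k"
      by (simp add: point_eval_dehom y1_def)
    then show "point_eval (w i * mvar j ^ k) x = point_eval (w j * mvar i ^ k) x"
      using ij wx x0 by (simp add: y_def power_divide)
  qed simp
  have split: "(\<Sum>i\<le>n. f i) = f 0 + (\<Sum>i=1..n. f i)" for f :: "nat \<Rightarrow> mpoly"
    by (metis One_nat_def sum.atMost_shift sum.shift_bounds_Suc_ivl sum.atLeast1_atMost_eq)
  have w0: "w 0 * (mvar 0 * mvar j ^ k) = w j * - ?F" if j: "j \<in> {1..n}" for j
  proof -
    have "mvar 0 * w 0 = - (\<Sum>i=1..n. mvar i * w i)"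
      using radial unfolding split by (simp add: eq_neg_iff_add_eq_0)
    moreover have "w 0 * (mvar 0 * mvar j ^ k) = (mvar 0 * w 0) * mvar j ^ k"
      by simp
    ultimately have "w 0 * (mvar 0 * mvar j ^ k) = - (\<Sum>i=1..n. mvar i * (w i * mvar j ^ k))"
      by (simp only: mult_minus_left sum_distrib_right mult.assoc)
    also have "(\<Sum>i=1..n. mvar i * (w i * mvar j ^ k)) = (\<Sum>i=1..n. mvar i * (w j * mvar i ^ k))"
      using ratio[OF _ j] by (intro sum.cong) auto
    also have "\<dots> = w j * ?F"
      by (simp add: fermat_one sum_distrib_left mult_ac)
    finally show ?thesis
      by simp
  qed
  have "w i * fermat_form n k j = w j * fermat_form n k i" if ij: "i \<le> n" "j \<le> n" for i j
    using ij w0[of i] w0[of j] ratio[of i j]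
    by (cases "i = 0"; cases "j = 0") (auto simp: fermat_form_def mult.left_commute[of _ "mvar 0"])
  then show ?thesis
    using hom fermat_form_in_hom_tuples[OF n] by (auto simp: proportional_def)
qed

section \<open>The Gauss map and its deck transformations\<close>

lemma complex_root_exists:
  assumes "k \<ge> 1"
  shows "\<exists>t::complex. t ^ k = y"
proof (cases "y = 0")
  case False
  then have "card {t. t ^ k = y} = k"
    using assms by (intro card_nth_roots) auto
  then show ?thesis
    using assms by (cases "{t. t ^ k = y} = {}") auto
qed (use assms in \<open>auto intro: exI[of _ 0]\<close>)

text \<open>Away from a hypersurface the equation \<open>G(x) = [y\<^sub>0 : t\<^sub>1\<^sup>k : \<dots> : t\<^sub>n\<^sup>k]\<close> is solved by
  \<open>x = (- (\<Sum> t\<^sub>i\<^sup>k\<^sup>+\<^sup>1) / y\<^sub>0, t)\<close>, and every point of the target has this form.\<close>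

lemma dominating_fermat_form:
  assumes n: "n \<ge> 1" and k: "k \<ge> 1"
  shows "dominating n (fermat_form n k)"
  unfolding dominating_def
proof (intro allI ballI impI)
  fix d P assume P: "P \<in> forms n d" and 0: "msubst (fermat_form n k) P = 0"
  define q where "q i = (if i = 0 then mvar 0 else mvar i ^ k)" for i
  have "msubst q P = 0"
  proof (rule mpoly_eqI[of "mvar 0 * fermat n k (\<lambda>_. 1)"])
    show "mvar 0 * fermat n k (\<lambda>_. 1) \<noteq> 0"
      using fermat_neq_0[OF n, of "\<lambda>_. 1" k] by simp
    fix y assume "point_eval (mvar 0 * fermat n k (\<lambda>_. 1)) y \<noteq> 0"
    then have y: "y 0 \<noteq> 0" "(\<Sum>i=1..n. y i ^ (k + 1)) \<noteq> 0"
      by simp_all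
    define c where "c = - (\<Sum>i=1..n. y i ^ (k + 1)) / y 0"
    define x where "x = y(0 := c)"
    have sum: "(\<Sum>i=1..n. x i ^ (k + 1)) = (\<Sum>i=1..n. y i ^ (k + 1))"
      by (intro sum.cong) (auto simp: x_def)
    have "point_eval P (\<lambda>i. point_eval (fermat_form n k i) x) = c ^ d * point_eval P (\<lambda>i. point_eval (q i) y)"
    proof (rule point_eval_form[OF P])
      fix i assume "i \<le> n"
      then show "point_eval (fermat_form n k i) x = c * point_eval (q i) y"
        using y sum by (auto simp: point_eval_fermat_form q_def x_def c_def)
    qed
    moreover have "point_eval P (\<lambda>i. point_eval (fermat_form n k i) x) = 0"
      using arg_cong[OF 0, of "\<lambda>p. point_eval p x"] by simp
    moreover have "c \<noteq> 0"
      using y by (simp add: c_def)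
    ultimately show "point_eval (msubst q P) y = point_eval 0 y"
      by simp
  qed
  have "point_eval P y = 0" for y
  proof -
    have "\<forall>i. \<exists>t. t ^ k = y i"
      using complex_root_exists[OF k] by blast
    then obtain t where t: "\<And>i. t i ^ k = y i"
      by metis
    have "point_eval (msubst q P) (t(0 := y 0)) = point_eval P y"
      unfolding point_eval_msubst
      by (rule arg_cong[of _ _ "point_eval P"]) (auto simp: q_def t)
    then show ?thesis
      unfolding \<open>msubst q P = 0\<close> by simp
  qed
  then show "P = 0"
    by (rule mpoly_zeroI)
qed

text \<open>At each point the two values differ by some root of unity. There are finitely many of these
  and polynomials form a domain, so one root of unity serves all points.\<close>

lemma mpoly_power_eqD:
  fixes a b :: mpoly
  assumes k: "k \<ge> 1" and eq: "a ^ k = b ^ k"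
  shows "\<exists>z. z ^ k = 1 \<and> a = mconst z * b"
proof -
  let ?U = "{z::complex. z ^ k = 1}"
  have fin: "finite ?U"
    using k by (intro finite_roots_unity) auto
  have "(\<Prod>z\<in>?U. a - mconst z * b) = 0"
  proof (rule mpoly_zeroI)
    fix x
    have "point_eval a x ^ k = point_eval b x ^ k"
      using arg_cong[OF eq, of "\<lambda>p. point_eval p x"] by simp
    then have "\<exists>z\<in>?U. point_eval a x = z * point_eval b x"
      using k by (cases "point_eval b x = 0")
        (auto intro: exI[of _ 1] exI[of _ "point_eval a x / point_eval b x"] simp: power_divide power_0_left)
    then show "point_eval (\<Prod>z\<in>?U. a - mconst z * b) x = 0"
      using fin by auto
  qed
  then show ?thesis
    using fin by auto
qed

text \<open>The Gauss map depends only on \<open>F / x\<^sub>0\<close> and the \<open>k\<close>-th powers of \<open>x\<^sub>1, \<dots>, x\<^sub>n\<close>. When these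
  variables are multiplied by \<open>k\<close>-th roots of unity, \<open>x\<^sub>0\<close> has to change by the same factor as \<open>F\<close>.\<close>

definition deck_tuple :: "nat \<Rightarrow> nat \<Rightarrow> (nat \<Rightarrow> complex) \<Rightarrow> nat \<Rightarrow> mpoly" where
  "deck_tuple n k \<zeta> i = (if i = 0 then mvar 0 * fermat n k \<zeta>
     else if i \<le> n then mconst (\<zeta> i) * mvar i * fermat n k (\<lambda>_. 1) else 0)"

definition unity_tuple :: "nat \<Rightarrow> nat \<Rightarrow> (nat \<Rightarrow> complex) \<Rightarrow> bool" where
  "unity_tuple n k \<zeta> \<longleftrightarrow> (\<forall>i\<in>{1..n}. \<zeta> i ^ k = 1)"

lemma unity_tuple_one [simp]: "unity_tuple n k (\<lambda>_. 1)"
  by (simp add: unity_tuple_def)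

lemma unity_tuple_mult:
  "unity_tuple n k \<zeta> \<Longrightarrow> unity_tuple n k \<eta> \<Longrightarrow> unity_tuple n k (\<lambda>i. \<zeta> i * \<eta> i)"
  by (simp add: unity_tuple_def power_mult_distrib)

lemma unity_tuple_neq_0: "k \<ge> 1 \<Longrightarrow> unity_tuple n k \<zeta> \<Longrightarrow> i \<in> {1..n} \<Longrightarrow> \<zeta> i \<noteq> 0"
  by (force simp: unity_tuple_def power_0_left)

lemma hom_tuples_mult:
  assumes f: "f \<in> hom_tuples n" and c: "c \<in> forms n e" "c \<noteq> 0"
  shows "(\<lambda>i. c * f i) \<in> hom_tuples n"
proof -
  obtain d where d: "\<And>i. i \<le> n \<Longrightarrow> f i \<in> forms n d"
    using f by (rule hom_tuples_degreeE) blast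
  obtain l where "l \<le> n" "f l \<noteq> 0"
    using f by (rule hom_tuples_nonzeroE)
  then show ?thesis
    using f c d by (intro hom_tuplesI[where d = "e + d" and l = l]) (auto simp: hom_tuples_def)
qed

lemma ratmap_mult:
  assumes f: "f \<in> hom_tuples n" and c: "c \<in> forms n e" "c \<noteq> 0"
  shows "ratmap n (\<lambda>i. c * f i) = ratmap n f"
  using hom_tuples_mult[OF assms] f by (simp add: ratmap_eq_iff proportional_def)

locale fermat_foliation =
  fixes n k :: nat
  assumes n: "n \<ge> 2" and k: "k \<ge> 1"
begin

abbreviation "F \<equiv> fermat n k (\<lambda>_. 1)"
abbreviation "G \<equiv> fermat_form n k"
abbreviation "\<delta> \<equiv> deck_tuple n k"
abbreviation "unity \<equiv> unity_tuple n k"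

lemma n_pos: "n \<ge> 1"
  using n by simp

lemma F_neq_0: "F \<noteq> 0"
  using fermat_neq_0[OF n_pos, of "\<lambda>_. 1" k] by simp

lemma fermat_unity_neq_0: "unity \<zeta> \<Longrightarrow> fermat n k \<zeta> \<noteq> 0"
  using n_pos k by (intro fermat_neq_0 unity_tuple_neq_0) auto

lemma G_in_hom_tuples: "G \<in> hom_tuples n"
  by (rule fermat_form_in_hom_tuples[OF n_pos])

lemma deck_tuple_neq_0:
  assumes "unity \<zeta>" "i \<le> n"
  shows "\<delta> \<zeta> i \<noteq> 0"
  using assms fermat_unity_neq_0[OF assms(1)] F_neq_0 unity_tuple_neq_0[OF k assms(1), of i]
  by (auto simp: deck_tuple_def)

lemma deck_tuple_in_forms: "\<delta> \<zeta> i \<in> forms n (k + 2)"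
proof -
  have "mvar 0 * fermat n k \<zeta> \<in> forms n (1 + (k + 1))"
    by (intro forms_mult forms_mvar fermat_in_forms) simp
  moreover have "mconst (\<zeta> i) * mvar i * F \<in> forms n (0 + 1 + (k + 1))" if "i \<le> n"
    using that by (intro forms_mult forms_const forms_mvar fermat_in_forms)
  ultimately show ?thesis
    by (auto simp: deck_tuple_def)
qed

lemma deck_tuple_in_hom_tuples: "unity \<zeta> \<Longrightarrow> \<delta> \<zeta> \<in> hom_tuples n"
  using deck_tuple_neq_0[of \<zeta> 0]
  by (intro hom_tuplesI[where d = "k + 2" and l = 0] deck_tuple_in_forms) (auto simp: deck_tuple_def)

lemma point_eval_deck_tuple:
  "point_eval (\<delta> \<zeta> i) x = (if i = 0 then x 0 * (\<Sum>i=1..n. \<zeta> i * x i ^ (k + 1))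
     else if i \<le> n then \<zeta> i * x i * (\<Sum>i=1..n. x i ^ (k + 1)) else 0)"
  by (simp add: deck_tuple_def)

text \<open>The twisted Fermat polynomials are permuted by the deck transformations up to a factor,
  because a \<open>k\<close>-th root of unity is its own \<open>(k + 1)\<close>-st power.\<close>

lemma fermat_at_deck_tuple:
  assumes \<eta>: "unity \<eta>"
  shows "(\<Sum>i=1..n. \<zeta> i * point_eval (\<delta> \<eta> i) x ^ (k + 1)) =
    (\<Sum>i=1..n. x i ^ (k + 1)) ^ (k + 1) * (\<Sum>i=1..n. \<zeta> i * \<eta> i * x i ^ (k + 1))"
  unfolding sum_distrib_left
proof (rule sum.cong[OF refl])
  fix i assume i: "i \<in> {1..n}"
  have \<eta>i: "\<eta> i ^ (k + 1) = \<eta> i"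
    using \<eta> i by (simp add: unity_tuple_def)
  have "point_eval (\<delta> \<eta> i) x ^ (k + 1) = \<eta> i * x i ^ (k + 1) * (\<Sum>i=1..n. x i ^ (k + 1)) ^ (k + 1)"
    using i by (simp add: point_eval_deck_tuple power_mult_distrib \<eta>i del: power_Suc Suc_eq_plus1 flip: Suc_eq_plus1)
       (use \<eta>i in \<open>simp add: mult_ac\<close>)
  then show "\<zeta> i * point_eval (\<delta> \<eta> i) x ^ (k + 1) =
      (\<Sum>i=1..n. x i ^ (k + 1)) ^ (k + 1) * (\<zeta> i * \<eta> i * x i ^ (k + 1))"
    by (simp only: mult_ac)
qed

lemma deck_tuple_comp:
  assumes \<eta>: "unity \<eta>"
  shows "msubst (\<delta> \<eta>) (\<delta> \<zeta> i) = fermat n k \<eta> * F ^ (k + 1) * \<delta> (\<lambda>i. \<zeta> i * \<eta> i) i"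
proof (rule mpoly_eq_iff[THEN iffD2, rule_format])
  fix x :: "nat \<Rightarrow> complex"
  let ?s = "\<Sum>i=1..n. x i ^ (k + 1)"
  have *: "(\<Sum>i=1..n. point_eval (\<delta> \<eta> i) x ^ (k + 1)) = ?s ^ (k + 1) * (\<Sum>i=1..n. \<eta> i * x i ^ (k + 1))"
    using fermat_at_deck_tuple[OF \<eta>, of "\<lambda>_. 1" x] by simp
  define y where "y = (\<lambda>i. point_eval (\<delta> \<eta> i) x)"
  have "point_eval (\<delta> \<zeta> i) y = (if i = 0 then y 0 * (?s ^ (k + 1) * (\<Sum>i=1..n. \<zeta> i * \<eta> i * x i ^ (k + 1)))
     else if i \<le> n then \<zeta> i * y i * (?s ^ (k + 1) * (\<Sum>i=1..n. \<eta> i * x i ^ (k + 1))) else 0)"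
    unfolding point_eval_deck_tuple[where x = y]
    by (simp only: y_def * fermat_at_deck_tuple[OF \<eta>])
  then show "point_eval (msubst (\<delta> \<eta>) (\<delta> \<zeta> i)) x =
      point_eval (fermat n k \<eta> * F ^ (k + 1) * \<delta> (\<lambda>i. \<zeta> i * \<eta> i) i) x"
    unfolding point_eval_msubst y_def[symmetric]
    by (simp add: point_eval_deck_tuple y_def del: power_Suc)
qed

lemma G_deck_tuple:
  assumes \<eta>: "unity \<eta>"
  shows "msubst (\<delta> \<eta>) (G i) = fermat n k \<eta> * F ^ k * G i"
proof (rule mpoly_eq_iff[THEN iffD2, rule_format])
  fix x :: "nat \<Rightarrow> complex"
  let ?s = "\<Sum>i=1..n. x i ^ (k + 1)"
  have *: "(\<Sum>i=1..n. point_eval (\<delta> \<eta> i) x ^ (k + 1)) = ?s ^ (k + 1) * (\<Sum>i=1..n. \<eta> i * x i ^ (k + 1))"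
    using fermat_at_deck_tuple[OF \<eta>, of "\<lambda>_. 1" x] by simp
  have \<eta>i: "\<eta> i ^ k = 1" if "i \<noteq> 0" "i \<le> n"
    using \<eta> that by (simp add: unity_tuple_def)
  show "point_eval (msubst (\<delta> \<eta>) (G i)) x = point_eval (fermat n k \<eta> * F ^ k * G i) x"
    unfolding point_eval_msubst point_eval_fermat_form *
    using \<eta>i by (simp add: point_eval_deck_tuple point_eval_fermat_form power_mult_distrib)
qed

lemma factor_in_forms: "fermat n k \<eta> * F ^ e \<in> forms n (k + 1 + e * (k + 1))"
  by (intro forms_mult forms_power fermat_in_forms)

lemma ratmap_deck_comp:
  assumes "unity \<zeta>" "unity \<eta>"
  shows "ratmap_comp n (ratmap n (\<delta> \<zeta>)) (ratmap n (\<delta> \<eta>)) = ratmap n (\<delta> (\<lambda>i. \<zeta> i * \<eta> i))"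
proof -
  let ?c = "fermat n k \<eta> * F ^ (k + 1)"
  have c: "?c \<noteq> 0"
    using fermat_unity_neq_0[OF assms(2)] F_neq_0 by simp
  have \<zeta>\<eta>: "unity (\<lambda>i. \<zeta> i * \<eta> i)"
    using assms by (rule unity_tuple_mult)
  have "msubst (\<delta> \<eta>) (\<delta> \<zeta> 0) \<noteq> 0"
    unfolding deck_tuple_comp[OF assms(2)] using c deck_tuple_neq_0[OF \<zeta>\<eta>, of 0] by simp
  then have "ratmap_comp n (ratmap n (\<delta> \<zeta>)) (ratmap n (\<delta> \<eta>)) = ratmap n (\<lambda>i. msubst (\<delta> \<eta>) (\<delta> \<zeta> i))"
    using assms by (intro ratmap_comp_ratmap[where l = 0] deck_tuple_in_hom_tuples) auto
  also have "\<dots> = ratmap n (\<delta> (\<lambda>i. \<zeta> i * \<eta> i))"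
    unfolding deck_tuple_comp[OF assms(2)]
    by (intro ratmap_mult[OF _ factor_in_forms] deck_tuple_in_hom_tuples \<zeta>\<eta> c)
  finally show ?thesis .
qed

lemma ratmap_G_deck:
  assumes "unity \<eta>"
  shows "ratmap_comp n (ratmap n G) (ratmap n (\<delta> \<eta>)) = ratmap n G"
proof -
  let ?c = "fermat n k \<eta> * F ^ k"
  have c: "?c \<noteq> 0"
    using fermat_unity_neq_0[OF assms] F_neq_0 by simp
  have "msubst (\<delta> \<eta>) (G 0) \<noteq> 0"
    unfolding G_deck_tuple[OF assms] using c fermat_form_neq_0[OF n_pos, of 0 k] by simp
  then have "ratmap_comp n (ratmap n G) (ratmap n (\<delta> \<eta>)) = ratmap n (\<lambda>i. msubst (\<delta> \<eta>) (G i))"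
    using assms by (intro ratmap_comp_ratmap[where l = 0] deck_tuple_in_hom_tuples G_in_hom_tuples) auto
  also have "\<dots> = ratmap n G"
    unfolding G_deck_tuple[OF assms] by (intro ratmap_mult[OF _ factor_in_forms] G_in_hom_tuples c)
  finally show ?thesis .
qed

lemma ratmap_deck_one: "ratmap n (\<delta> (\<lambda>_. 1)) = ratmap_id n"
proof -
  have "\<delta> (\<lambda>_. 1) = (\<lambda>i. F * id_tuple n i)"
    by (auto simp: deck_tuple_def id_tuple_def fun_eq_iff mult.commute)
  then show ?thesis
    using ratmap_mult[OF id_tuple_in_hom_tuples fermat_in_forms F_neq_0] by (simp add: ratmap_id_eq)
qed

lemma deck_tuple_cong: "(\<And>i. i \<in> {1..n} \<Longrightarrow> \<zeta> i = \<eta> i) \<Longrightarrow> \<delta> \<zeta> = \<delta> \<eta>"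
  by (auto simp: deck_tuple_def fermat_def fun_eq_iff intro!: sum.cong)

lemma ratmap_deck_in_deck_group:
  assumes \<zeta>: "unity \<zeta>"
  shows "ratmap n (\<delta> \<zeta>) \<in> carrier (deck_group n (ratmap n G))"
proof -
  let ?\<eta> = "\<lambda>i. inverse (\<zeta> i)"
  have \<eta>: "unity ?\<eta>"
    using \<zeta> by (simp add: unity_tuple_def power_inverse)
  have "\<delta> (\<lambda>i. \<zeta> i * ?\<eta> i) = \<delta> (\<lambda>_. 1)" "\<delta> (\<lambda>i. ?\<eta> i * \<zeta> i) = \<delta> (\<lambda>_. 1)"
    using unity_tuple_neq_0[OF k \<zeta>] by (auto intro!: deck_tuple_cong)
  then have "ratmap_comp n (ratmap n (\<delta> \<zeta>)) (ratmap n (\<delta> ?\<eta>)) = ratmap_id n"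
    "ratmap_comp n (ratmap n (\<delta> ?\<eta>)) (ratmap n (\<delta> \<zeta>)) = ratmap_id n"
    using ratmap_deck_comp[OF \<zeta> \<eta>] ratmap_deck_comp[OF \<eta> \<zeta>] by (simp_all add: ratmap_deck_one)
  then show ?thesis
    using \<zeta> \<eta> ratmap_G_deck[OF \<zeta>] deck_tuple_in_hom_tuples
    by (auto simp: deck_group_def bir_group_def intro!: bexI[of _ "ratmap n (\<delta> ?\<eta>)"])
qed

text \<open>A deck transformation preserves the \<open>k\<close>-th powers of the ratios \<open>x\<^sub>i / x\<^sub>n\<close>, so it multiplies
  the ratios by roots of unity, and the remaining coordinate is then forced.\<close>

lemma deck_group_cases:
  assumes "\<phi> \<in> carrier (deck_group n (ratmap n G))"
  obtains \<zeta> where "unity \<zeta>" "\<zeta> n = 1" "\<phi> = ratmap n (\<delta> \<zeta>)"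
proof -
  have bir: "\<phi> \<in> carrier (bir_group n)" and comp: "ratmap_comp n (ratmap n G) \<phi> = ratmap n G"
    using assms by (auto simp: deck_group_def)
  then obtain f where f: "f \<in> hom_tuples n" and \<phi>: "\<phi> = ratmap n f"
    by (auto simp: bir_group_def elim: rational_mapsE)
  have dom: "dominating n f"
    using bir f unfolding \<phi> by (rule dominating_if_birational)
  have f_neq_0: "f i \<noteq> 0" if "i \<le> n" for i
    using dominatingD[OF dom forms_mvar[OF that]] by auto
  have sub: "msubst f (G 0) \<noteq> 0"
    using dominatingD[OF dom fermat_form_in_forms] fermat_form_neq_0[OF n_pos, of 0 k] by blast
  have "ratmap n (\<lambda>i. msubst f (G i)) = ratmap n G"
    using comp ratmap_comp_ratmap[OF G_in_hom_tuples f _ sub] by (simp add: \<phi>)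
  then have same: "((\<lambda>i. msubst f (G i)), G) \<in> proportional n"
    using comp_tuple_in_hom_tuples[OF G_in_hom_tuples f _ sub] G_in_hom_tuples
    by (simp add: ratmap_eq_iff)
  have "(f i * mvar n) ^ k = (f n * mvar i) ^ k" if "i \<in> {1..n}" for i
  proof -
    have "f 0 * f i ^ k * (mvar 0 * mvar n ^ k) = f 0 * f n ^ k * (mvar 0 * mvar i ^ k)"
      using proportionalD[OF same, of i n] that n by (simp add: fermat_form_def)
    then have "(f 0 * mvar 0) * (f i * mvar n) ^ k = (f 0 * mvar 0) * (f n * mvar i) ^ k"
      by (simp add: power_mult_distrib mult_ac)
    then show ?thesis
      using f_neq_0[of 0] by simp
  qed
  then have "\<forall>i\<in>{1..n}. \<exists>z. z ^ k = 1 \<and> f i * mvar n = mconst z * (f n * mvar i)"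
    using mpoly_power_eqD[OF k] by blast
  then obtain \<zeta>' where \<zeta>': "\<And>i. i \<in> {1..n} \<Longrightarrow> \<zeta>' i ^ k = 1 \<and> f i * mvar n = mconst (\<zeta>' i) * (f n * mvar i)"
    by metis
  define \<zeta> where "\<zeta> = \<zeta>'(n := 1)"
  have \<zeta>: "unity \<zeta>"
    using \<zeta>' by (auto simp: \<zeta>_def unity_tuple_def)
  have fi: "f i * mvar n = mconst (\<zeta> i) * (f n * mvar i)" if "i \<in> {1..n}" for i
    using \<zeta>'[OF that] by (auto simp: \<zeta>_def)
  have "mvar n ^ (k + 1) * (\<Sum>i=1..n. f i ^ (k + 1)) = (\<Sum>i=1..n. (f i * mvar n) ^ (k + 1))"
    by (simp only: sum_distrib_left power_mult_distrib mult.commute)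
  also have "\<dots> = (\<Sum>i=1..n. f n ^ (k + 1) * (mconst (\<zeta> i) * mvar i ^ (k + 1)))"
  proof (rule sum.cong[OF refl])
    fix i assume i: "i \<in> {1..n}"
    have "mconst (\<zeta> i) ^ (k + 1) = mconst (\<zeta> i)"
      using \<zeta> i by (simp add: mpoly_eq_iff unity_tuple_def)
    then show "(f i * mvar n) ^ (k + 1) = f n ^ (k + 1) * (mconst (\<zeta> i) * mvar i ^ (k + 1))"
      unfolding fi[OF i] power_mult_distrib by (simp only: mult_ac)
  qed
  also have "\<dots> = f n ^ (k + 1) * fermat n k \<zeta>"
    by (simp only: fermat_def sum_distrib_left)
  finally have sum: "mvar n ^ (k + 1) * (\<Sum>i=1..n. f i ^ (k + 1)) = f n ^ (k + 1) * fermat n k \<zeta>" .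
  have "(\<Sum>i=1..n. f i ^ (k + 1)) * (mvar 0 * mvar n ^ k) = f 0 * f n ^ k * F"
    using proportionalD[OF same, of 0 n] n by (simp add: fermat_form_def fermat_one)
  then have "mvar n ^ (k + 1) * ((\<Sum>i=1..n. f i ^ (k + 1)) * (mvar 0 * mvar n ^ k)) =
      mvar n ^ (k + 1) * (f 0 * f n ^ k * F)"
    by (simp only:)
  then have "f n ^ (k + 1) * fermat n k \<zeta> * (mvar 0 * mvar n ^ k) = mvar n ^ (k + 1) * (f 0 * f n ^ k * F)"
    by (simp only: mult.assoc[symmetric] sum)
  then have "(f n ^ k * mvar n ^ k) * (f n * (mvar 0 * fermat n k \<zeta>)) = (f n ^ k * mvar n ^ k) * (f 0 * (mvar n * F))"
    by (simp add: mult_ac)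
  then have f0: "f 0 * (mvar n * F) = f n * (mvar 0 * fermat n k \<zeta>)"
    using f_neq_0[of n] by simp
  have "(f, \<delta> \<zeta>) \<in> proportional n"
  proof (rule proportionalI[OF f deck_tuple_in_hom_tuples[OF \<zeta>], of n])
    show "f n \<noteq> 0" "\<delta> \<zeta> n \<noteq> 0"
      using f_neq_0 deck_tuple_neq_0[OF \<zeta>] by auto
    fix i assume i: "i \<le> n"
    have \<delta>n: "\<delta> \<zeta> n = mvar n * F"
      using n by (simp add: deck_tuple_def \<zeta>_def)
    show "f i * \<delta> \<zeta> n = f n * \<delta> \<zeta> i"
    proof (cases "i = 0")
      case True
      then show ?thesis
        using f0 by (simp add: \<delta>n) (simp add: deck_tuple_def)
    next
      case False
      then have "f i * mvar n * F = mconst (\<zeta> i) * (f n * mvar i) * F"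
        using fi[of i] i by simp
      then show ?thesis
        using False i by (simp add: \<delta>n mult_ac) (simp add: deck_tuple_def mult_ac)
    qed
  qed simp
  then have "\<phi> = ratmap n (\<delta> \<zeta>)"
    using f \<zeta> deck_tuple_in_hom_tuples by (simp add: \<phi> ratmap_eq_iff)
  moreover have "\<zeta> n = 1"
    by (simp add: \<zeta>_def)
  ultimately show ?thesis
    using that \<zeta> by blast
qed

lemma ratmap_deck_inject:
  assumes "unity \<zeta>" "unity \<eta>" and eq: "ratmap n (\<delta> \<zeta>) = ratmap n (\<delta> \<eta>)"
    and 1: "\<zeta> n = 1" "\<eta> n = 1" and i: "i \<in> {1..n}"
  shows "\<zeta> i = \<eta> i"
proof -
  have "(\<delta> \<zeta>, \<delta> \<eta>) \<in> proportional n"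
    using assms deck_tuple_in_hom_tuples by (simp flip: ratmap_eq_iff)
  then have "\<delta> \<zeta> i * \<delta> \<eta> n = \<delta> \<zeta> n * \<delta> \<eta> i"
    using i by (intro proportionalD) auto
  then have "mconst (\<zeta> i) * (mvar i * F * (mvar n * F)) = mconst (\<eta> i) * (mvar i * F * (mvar n * F))"
    using i n 1 by (simp add: deck_tuple_def mult_ac)
  then have "mconst (\<zeta> i) = mconst (\<eta> i)"
    using F_neq_0 by simp
  then show ?thesis
    by (metis lookup_single_eq)
qed

end

text \<open>A common factor of all \<open>\<zeta>\<^sub>i\<close> does not change the deck transformation. Normalising \<open>\<zeta>\<^sub>n\<close> to 1
  leaves \<open>n - 1\<close> free roots of unity; the coordinates of the product group start at 0.\<close>

definition unity_of :: "nat \<Rightarrow> nat \<Rightarrow> (nat \<Rightarrow> int) \<Rightarrow> nat \<Rightarrow> complex" where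
  "unity_of n k z i = (if i \<in> {1..<n} then cis (2 * pi * real_of_int (z (i - 1)) / real k) else 1)"

lemma cis_mod:
  assumes "k \<ge> 1"
  shows "cis (2 * pi * real_of_int (a mod int k) / real k) = cis (2 * pi * real_of_int a / real k)"
proof -
  have "real_of_int a = real k * real_of_int (a div int k) + real_of_int (a mod int k)"
    by (metis mult_div_mod_eq of_int_add of_int_mult of_int_of_nat_eq)
  then have "2 * pi * real_of_int a / real k =
      2 * pi * real_of_int (a div int k) + 2 * pi * real_of_int (a mod int k) / real k"
    using assms by (simp add: field_simps)
  moreover have "cis (2 * pi * real_of_int (a div int k)) = 1"
    by (rule cis_multiple_2pi) simp
  ultimately show ?thesis
    by (simp flip: cis_mult)
qed

lemma cis_bij:
  assumes "k \<ge> 1"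
  shows "bij_betw (\<lambda>a. cis (2 * pi * real_of_int a / real k)) {0..<int k} {z. z ^ k = 1}"
proof -
  have "bij_betw int {..<k} {0..<int k}"
    by (rule bij_betwI[where g = nat]) auto
  moreover have "bij_betw (\<lambda>a. cis (2 * pi * real a / real k)) {..<k} {z. z ^ k = 1}"
    using assms by (intro bij_betw_roots_unity) auto
  ultimately show ?thesis
    using bij_betw_comp_iff[of int "{..<k}" "{0..<int k}"
        "\<lambda>a. cis (2 * pi * real_of_int a / real k)" "{z. z ^ k = 1}"]
    by (simp add: comp_def)
qed

context fermat_foliation
begin

lemma unity_of: "unity (unity_of n k z)"
  using k by (auto simp: unity_tuple_def unity_of_def DeMoivre intro!: cis_multiple_2pi)

theorem deck_group_iso:
  "deck_group n (ratmap n G) \<cong> product_group {..<n - 1} (\<lambda>_. integer_mod_group k)"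
proof -
  let ?A = "product_group {..<n - 1} (\<lambda>_. integer_mod_group k)" and ?D = "deck_group n (ratmap n G)"
  let ?e = "\<lambda>a. cis (2 * pi * real_of_int a / real k)"
  let ?\<Phi> = "\<lambda>z. ratmap n (\<delta> (unity_of n k z))"
  have carr: "carrier (integer_mod_group k) = {0..<int k}"
    using k by (simp add: carrier_integer_mod_group)
  interpret A: group ?A
    by (rule product_group) simp
  have "?\<Phi> \<in> hom ?A ?D"
  proof (rule homI)
    show "?\<Phi> z \<in> carrier ?D" for z
      by (rule ratmap_deck_in_deck_group[OF unity_of])
    fix z w
    have "\<delta> (unity_of n k (z \<otimes>\<^bsub>?A\<^esub> w)) = \<delta> (\<lambda>i. unity_of n k z i * unity_of n k w i)"
    proof (rule deck_tuple_cong)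
      fix i
      show "unity_of n k (z \<otimes>\<^bsub>?A\<^esub> w) i = unity_of n k z i * unity_of n k w i"
      proof (cases "i \<in> {1..<n}")
        case True
        then have "i - Suc 0 < n - Suc 0"
          by auto
        with True have "unity_of n k (z \<otimes>\<^bsub>?A\<^esub> w) i = ?e ((z (i - 1) + w (i - 1)) mod int k)"
          by (simp add: unity_of_def)
        also have "\<dots> = ?e (z (i - 1)) * ?e (w (i - 1))"
          unfolding cis_mod[OF k] by (simp add: cis_mult add_divide_distrib distrib_left)
        finally show ?thesis
          using True by (simp add: unity_of_def)
      qed (auto simp: unity_of_def)
    qed
    then show "?\<Phi> (z \<otimes>\<^bsub>?A\<^esub> w) = ?\<Phi> z \<otimes>\<^bsub>?D\<^esub> ?\<Phi> w"
      by (simp add: deck_group_def bir_group_def ratmap_deck_comp[OF unity_of unity_of])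
  qed
  moreover have "bij_betw ?\<Phi> (carrier ?A) (carrier ?D)"
  proof (rule bij_betw_imageI)
    show "inj_on ?\<Phi> (carrier ?A)"
    proof (rule inj_onI)
      fix z w assume zw: "z \<in> carrier ?A" "w \<in> carrier ?A" and eq: "?\<Phi> z = ?\<Phi> w"
      show "z = w"
      proof (rule PiE_ext)
        show "z \<in> PiE {..<n - 1} (\<lambda>_. {0..<int k})" "w \<in> PiE {..<n - 1} (\<lambda>_. {0..<int k})"
          using zw by (simp_all add: carr)
        fix j assume j: "j \<in> {..<n - 1}"
        have "unity_of n k z (Suc j) = unity_of n k w (Suc j)"
          using j by (intro ratmap_deck_inject[OF unity_of unity_of eq]) (auto simp: unity_of_def)
        moreover have "Suc j < n"
          using j by auto
        ultimately have "?e (z j) = ?e (w j)"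
          by (simp add: unity_of_def)
        moreover have "z j \<in> {0..<int k}" "w j \<in> {0..<int k}"
          using zw j carr by (auto simp: PiE_iff)
        ultimately show "z j = w j"
          using bij_betw_imp_inj_on[OF cis_bij[OF k]] by (auto dest: inj_onD)
      qed
    qed
    show "?\<Phi> ` carrier ?A = carrier ?D"
    proof (intro equalityI subsetI)
      fix \<phi> assume "\<phi> \<in> carrier ?D"
      then obtain \<zeta> where \<zeta>: "unity \<zeta>" "\<zeta> n = 1" "\<phi> = ratmap n (\<delta> \<zeta>)"
        by (rule deck_group_cases)
      have "\<exists>a\<in>{0..<int k}. ?e a = \<zeta> (Suc j)" if "j \<in> {..<n - 1}" for j
      proof -
        have "\<zeta> (Suc j) \<in> {z. z ^ k = 1}"
          using \<zeta>(1) that by (auto simp: unity_tuple_def)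
        then show ?thesis
          unfolding bij_betw_imp_surj_on[OF cis_bij[OF k], symmetric] by auto
      qed
      then obtain a where a: "\<And>j. j \<in> {..<n - 1} \<Longrightarrow> a j \<in> {0..<int k} \<and> ?e (a j) = \<zeta> (Suc j)"
        by metis
      define z where "z = restrict a {..<n - 1}"
      have "\<delta> (unity_of n k z) = \<delta> \<zeta>"
      proof (rule deck_tuple_cong)
        fix i assume i: "i \<in> {1..n}"
        show "unity_of n k z i = \<zeta> i"
        proof (cases "i = n")
          case False
          then have "i - 1 \<in> {..<n - 1}" "Suc (i - 1) = i"
            using i by auto
          then show ?thesis
            using a[of "i - 1"] i False by (auto simp: unity_of_def z_def)
        qed (use \<zeta>(2) in \<open>simp add: unity_of_def\<close>)
      qed
      moreover have "z \<in> carrier ?A"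
        using a by (auto simp: z_def carr)
      ultimately show "\<phi> \<in> ?\<Phi> ` carrier ?A"
        using \<zeta>(3) by (intro image_eqI[of _ _ z]) simp_all
    next
      fix \<phi> assume "\<phi> \<in> ?\<Phi> ` carrier ?A"
      then show "\<phi> \<in> carrier ?D"
        using ratmap_deck_in_deck_group[OF unity_of] by blast
    qed
  qed
  ultimately have "?\<Phi> \<in> iso ?A ?D"
    by (simp add: iso_def)
  then show ?thesis
    by (intro A.iso_sym) (auto simp: is_iso_def)
qed

end

section \<open>The fixed field of the deck transformations\<close>

lemma msubst_mult_form:
  assumes "P \<in> forms n d"
  shows "msubst (\<lambda>i. c * g i) P = c ^ d * msubst g P"
proof (rule mpoly_eq_iff[THEN iffD2, rule_format])
  fix x :: "nat \<Rightarrow> complex"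
  have "point_eval P (\<lambda>i. point_eval (c * g i) x) = point_eval c x ^ d * point_eval P (\<lambda>i. point_eval (g i) x)"
    by (rule point_eval_form[OF assms]) simp
  then show "point_eval (msubst (\<lambda>i. c * g i) P) x = point_eval (c ^ d * msubst g P) x"
    by simp
qed

text \<open>The Gauss map in the coordinates \<open>u, x\<^sub>1, \<dots>, x\<^sub>n\<close> with \<open>u = F / x\<^sub>0\<close>, where the variable \<open>x\<^sub>0\<close>
  stands for \<open>u\<close>.\<close>

definition power_tuple :: "nat \<Rightarrow> nat \<Rightarrow> mpoly" where
  "power_tuple k i = (if i = 0 then - mvar 0 else mvar i ^ k)"

text \<open>The form is found by dividing all exponents of \<open>x\<^sub>1, \<dots>, x\<^sub>n\<close> by \<open>k\<close>; the weight \<open>k\<close> of \<open>x\<^sub>0\<close>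
  makes its degree constant.\<close>

lemma form_in_power_tuple:
  assumes k: "k \<ge> 1"
    and vars: "\<And>m. m \<in> Poly_Mapping.keys p \<Longrightarrow> Poly_Mapping.keys m \<subseteq> {..n}"
    and dvd: "\<And>m i. m \<in> Poly_Mapping.keys p \<Longrightarrow> i \<in> {1..n} \<Longrightarrow> k dvd Poly_Mapping.lookup m i"
    and weight: "\<And>m. m \<in> Poly_Mapping.keys p \<Longrightarrow>
      (\<Sum>i\<le>n. (if i = 0 then k else 1) * Poly_Mapping.lookup m i) = k * e"
  shows "\<exists>A\<in>forms n e. p = msubst (power_tuple k) A"
proof
  let ?r = "\<lambda>m. Poly_Mapping.mapp (\<lambda>i e. if i = 0 then e else e div k) m :: nat \<Rightarrow>\<^sub>0 nat"
  let ?s = "\<lambda>m. (-1) ^ Poly_Mapping.lookup m 0 * Poly_Mapping.lookup p m"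
  let ?A = "\<Sum>m\<in>Poly_Mapping.keys p. Poly_Mapping.single (?r m) (?s m)"
  have r: "Poly_Mapping.lookup (?r m) i =
      (if i = 0 then Poly_Mapping.lookup m i else Poly_Mapping.lookup m i div k)" for m i
    by (auto simp: lookup_mapp when_def in_keys_iff)
  have keys_r: "Poly_Mapping.keys (?r m) \<subseteq> {..n}" if "m \<in> Poly_Mapping.keys p" for m
    by (rule subset_trans[OF keys_mapp_subset vars[OF that]])
  show "?A \<in> forms n e"
  proof (rule forms_sum)
    fix m assume m: "m \<in> Poly_Mapping.keys p"
    have "k * (\<Sum>i\<le>n. Poly_Mapping.lookup (?r m) i) =
        (\<Sum>i\<le>n. (if i = 0 then k else 1) * Poly_Mapping.lookup m i)"
      unfolding sum_distrib_left
    proof (rule sum.cong[OF refl])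
      fix i assume "i \<in> {..n}"
      then show "k * Poly_Mapping.lookup (?r m) i = (if i = 0 then k else 1) * Poly_Mapping.lookup m i"
        using dvd[OF m, of i] by (simp add: r)
    qed
    then have "(\<Sum>i\<le>n. Poly_Mapping.lookup (?r m) i) = e"
      using weight[OF m] k by simp
    then show "Poly_Mapping.single (?r m) (?s m) \<in> forms n e"
      using keys_r[OF m] by (auto simp: forms_iff)
  qed
  show "p = msubst (power_tuple k) ?A"
  proof (rule mpoly_eq_iff[THEN iffD2, rule_format])
    fix x :: "nat \<Rightarrow> complex"
    let ?y = "\<lambda>i. point_eval (power_tuple k i) x"
    have "monomial_eval ?y (?r m) = (-1) ^ Poly_Mapping.lookup m 0 * monomial_eval x m" if m: "m \<in> Poly_Mapping.keys p" for m
    proof -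
      have "monomial_eval ?y (?r m) = (\<Prod>i\<le>n. ?y i ^ Poly_Mapping.lookup (?r m) i)"
        using keys_r[OF m] by (intro monomial_eval_superset) auto
      also have "\<dots> = (\<Prod>i\<le>n. (if i = 0 then (-1) ^ Poly_Mapping.lookup m 0 else 1) * x i ^ Poly_Mapping.lookup m i)"
      proof (rule prod.cong[OF refl])
        fix i assume "i \<in> {..n}"
        then show "?y i ^ Poly_Mapping.lookup (?r m) i =
            (if i = 0 then (-1) ^ Poly_Mapping.lookup m 0 else 1) * x i ^ Poly_Mapping.lookup m i"
          using dvd[OF m, of i] by (auto simp: power_tuple_def r power_mult[symmetric] power_mult_distrib[symmetric])
      qed
      also have "\<dots> = (-1) ^ Poly_Mapping.lookup m 0 * monomial_eval x m"
        using vars[OF m] by (simp add: prod.distrib monomial_eval_superset[of "{..n}"])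
      finally show ?thesis .
    qed
    then have "point_eval ?A ?y = (\<Sum>m\<in>Poly_Mapping.keys p. Poly_Mapping.lookup p m * monomial_eval x m)"
      by (auto simp: mult_ac power_mult_distrib[symmetric] intro!: sum.cong simp flip: mult.assoc)
    then show "point_eval p x = point_eval (msubst (power_tuple k) ?A) x"
      by (simp only: point_eval_msubst) (simp add: meval_eq_sum_monomials)
  qed
qed

text \<open>If \<open>P / Q = M / N\<close> is invariant under a diagonal matrix, then \<open>M = (P / Q) N\<close> has the same
  weight as \<open>N\<close>.\<close>

lemma semi_invariant_numerator:
  assumes MN: "M * Q = P * N" and Q: "Q \<noteq> 0" and c: "\<And>i. c i \<noteq> 0"
    and inv: "mscale c P * Q = P * mscale c Q" and N: "mscale c N = mconst a * N"
  shows "mscale c M = mconst a * M"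
proof (rule mpoly_eqI[of "Q * mscale c Q"])
  show "Q * mscale c Q \<noteq> 0"
    using Q c by (simp add: mscale_eq_0_iff)
  fix x assume nz: "point_eval (Q * mscale c Q) x \<noteq> 0"
  let ?x = "\<lambda>i. c i * x i"
  have 1: "point_eval M ?x * point_eval Q ?x = point_eval P ?x * point_eval N ?x"
    "point_eval M x * point_eval Q x = point_eval P x * point_eval N x"
    using MN by (metis point.meval_mult)+
  have 2: "point_eval P ?x * point_eval Q x = point_eval P x * point_eval Q ?x"
    using inv by (metis point.meval_mult point_eval_mscale)
  have 3: "point_eval N ?x = a * point_eval N x"
    using arg_cong[OF N, of "\<lambda>p. point_eval p x"] by simp
  have "(point_eval Q x * point_eval Q ?x) * point_eval M ?x =
      (point_eval M ?x * point_eval Q ?x) * point_eval Q x"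
    by simp
  also have "\<dots> = a * point_eval N x * (point_eval P ?x * point_eval Q x)"
    unfolding 1 3 by simp
  also have "\<dots> = a * (point_eval P x * point_eval N x) * point_eval Q ?x"
    unfolding 2 by simp
  also have "\<dots> = (point_eval Q x * point_eval Q ?x) * (a * point_eval M x)"
    unfolding 1(2)[symmetric] by simp
  finally show "point_eval (mscale c M) x = point_eval (mconst a * M) x"
    using nz by simp
qed

context fermat_foliation
begin

text \<open>Only the values on \<open>{1..n}\<close> matter; fixing the others makes the set finite.\<close>

definition roots_group :: "(nat \<Rightarrow> complex) set" where
  "roots_group = PiE {1..n} (\<lambda>_. {z. z ^ k = 1})"

definition torus :: "(nat \<Rightarrow> complex) \<Rightarrow> nat \<Rightarrow> complex" where
  "torus \<zeta> i = (if i \<in> {1..n} then \<zeta> i else 1)"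

lemma unity_roots_group: "\<zeta> \<in> roots_group \<Longrightarrow> unity \<zeta>"
  by (auto simp: roots_group_def unity_tuple_def)

lemma restrict_roots_group: "unity \<zeta> \<Longrightarrow> restrict \<zeta> {1..n} \<in> roots_group"
  by (auto simp: roots_group_def unity_tuple_def)

lemma finite_roots_group: "finite roots_group"
  unfolding roots_group_def using k by (intro finite_PiE finite_roots_unity) auto

lemma torus_neq_0: "unity \<zeta> \<Longrightarrow> torus \<zeta> i \<noteq> 0"
  using unity_tuple_neq_0[OF k] by (auto simp: torus_def)

lemma torus_restrict [simp]: "torus (restrict \<zeta> {1..n}) = torus \<zeta>"
  by (auto simp: torus_def)

lemma torus_mult: "torus (\<lambda>i. \<zeta> i * \<eta> i) = (\<lambda>i. torus \<zeta> i * torus \<eta> i)"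
  by (auto simp: torus_def)

text \<open>The substitution \<open>x\<^sub>0 \<mapsto> F / x\<^sub>0\<close>, cleared of denominators by homogeneity, turns the deck
  transformations into diagonal matrices.\<close>

definition linearizer :: "nat \<Rightarrow> mpoly" where
  "linearizer i = (if i = 0 then F else mvar 0 * mvar i)"

lemma point_eval_linearizer:
  "point_eval (linearizer i) x = (if i = 0 then (\<Sum>i=1..n. x i ^ (k + 1)) else x 0 * x i)"
  by (simp add: linearizer_def)

text \<open>The substitution \<open>x\<^sub>0 \<mapsto> F / x\<^sub>0\<close> is an involution, so it is undone by evaluating at a point
  that has been transformed in the same way.\<close>

lemma linearizer_cancel:
  assumes P: "P \<in> forms n d" and y: "y 0 \<noteq> 0"
  defines "c \<equiv> (\<Sum>i=1..n. y i ^ (k + 1)) / y 0"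
  shows "point_eval (msubst linearizer P) (y(0 := c)) = c ^ d * point_eval P y"
  unfolding point_eval_msubst
proof (rule point_eval_form[OF P])
  fix i
  have "(\<Sum>i=1..n. (y(0 := c)) i ^ (k + 1)) = (\<Sum>i=1..n. y i ^ (k + 1))"
    by (intro sum.cong) auto
  then show "point_eval (linearizer i) (y(0 := c)) = c * y i"
    unfolding point_eval_linearizer using y by (auto simp: c_def)
qed

lemma msubst_linearizer_neq_0:
  assumes P: "P \<in> forms n d" "P \<noteq> 0"
  shows "msubst linearizer P \<noteq> 0"
proof
  assume 0: "msubst linearizer P = 0"
  have "P = 0"
  proof (rule mpoly_eqI[of "mvar 0 * F"])
    show "mvar 0 * F \<noteq> 0"
      using F_neq_0 by simp
    fix y assume "point_eval (mvar 0 * F) y \<noteq> 0"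
    then have y: "y 0 \<noteq> 0" "(\<Sum>i=1..n. y i ^ (k + 1)) \<noteq> 0"
      by simp_all
    then show "point_eval P y = point_eval 0 y"
      using linearizer_cancel[where y = y, OF P(1) y(1)] unfolding 0 by simp
  qed
  with P show False
    by simp
qed

lemma deck_linearizer:
  assumes P: "P \<in> forms n d" and \<zeta>: "unity \<zeta>"
  defines "c \<equiv> mvar 0 ^ (k + 1) * F"
  shows "msubst linearizer (msubst (\<delta> \<zeta>) P) = c ^ d * mscale (torus \<zeta>) (msubst linearizer P)"
proof (rule mpoly_eq_iff[THEN iffD2, rule_format])
  fix x :: "nat \<Rightarrow> complex"
  define w where "w = (\<lambda>i. point_eval (linearizer i) x)"
  let ?s = "\<Sum>i=1..n. x i ^ (k + 1)"
  have pow: "\<eta> i * w i ^ (k + 1) = x 0 ^ (k + 1) * (\<eta> i * x i ^ (k + 1))" if "i \<in> {1..n}" for \<eta> i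
    using that by (simp add: w_def point_eval_linearizer power_mult_distrib)
  have sum: "(\<Sum>i=1..n. \<eta> i * w i ^ (k + 1)) = x 0 ^ (k + 1) * (\<Sum>i=1..n. \<eta> i * x i ^ (k + 1))" for \<eta>
    unfolding sum_distrib_left by (intro sum.cong refl pow)
  have sum1: "(\<Sum>i=1..n. w i ^ (k + 1)) = x 0 ^ (k + 1) * ?s"
    using sum[of "\<lambda>_. 1"] by simp
  have tor: "(\<Sum>i=1..n. (torus \<zeta> i * x i) ^ (k + 1)) = (\<Sum>i=1..n. \<zeta> i * x i ^ (k + 1))"
    using \<zeta> by (intro sum.cong) (auto simp: torus_def unity_tuple_def power_mult_distrib)
  have "point_eval P (\<lambda>i. point_eval (\<delta> \<zeta> i) w) =
      (x 0 ^ (k + 1) * ?s) ^ d * point_eval P (\<lambda>i. point_eval (linearizer i) (\<lambda>i. torus \<zeta> i * x i))"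
  proof (rule point_eval_form[OF P])
    fix i assume i: "i \<le> n"
    have w0: "w 0 = ?s"
      by (simp add: w_def point_eval_linearizer)
    show "point_eval (\<delta> \<zeta> i) w =
        x 0 ^ (k + 1) * ?s * point_eval (linearizer i) (\<lambda>i. torus \<zeta> i * x i)"
    proof (cases "i = 0")
      case True
      then show ?thesis
        unfolding point_eval_deck_tuple point_eval_linearizer sum sum1 tor by (simp add: w0)
    next
      case False
      then have "w i = x 0 * x i" "torus \<zeta> i = \<zeta> i" "torus \<zeta> 0 = 1"
        using i by (auto simp: w_def point_eval_linearizer torus_def)
      then show ?thesis
        using False i unfolding point_eval_deck_tuple point_eval_linearizer sum sum1 tor by simp
    qed
  qed
  then show "point_eval (msubst linearizer (msubst (\<delta> \<zeta>) P)) x =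
      point_eval (c ^ d * mscale (torus \<zeta>) (msubst linearizer P)) x"
    by (simp add: w_def c_def)
qed

lemma mscale_linearizer_weight:
  assumes P: "P \<in> forms n d"
  shows "mscale (\<lambda>i. if i = 0 then 2 ^ k else 2) (msubst linearizer P) =
    mconst (2 ^ ((k + 1) * d)) * msubst linearizer P"
proof (rule mpoly_eq_iff[THEN iffD2, rule_format])
  fix x :: "nat \<Rightarrow> complex"
  have "point_eval P (\<lambda>i. point_eval (linearizer i) (\<lambda>i. (if i = 0 then 2 ^ k else 2) * x i)) =
      (2 ^ (k + 1)) ^ d * point_eval P (\<lambda>i. point_eval (linearizer i) x)"
  proof (rule point_eval_form[OF P])
    fix i
    have "(\<Sum>i=1..n. ((if i = 0 then 2 ^ k else 2) * x i) ^ (k + 1)) = 2 ^ (k + 1) * (\<Sum>i=1..n. x i ^ (k + 1))"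
      unfolding sum_distrib_left by (intro sum.cong) (auto simp: power_mult_distrib)
    then show "point_eval (linearizer i) (\<lambda>i. (if i = 0 then 2 ^ k else 2) * x i) =
        2 ^ (k + 1) * point_eval (linearizer i) x"
      unfolding point_eval_linearizer by simp
  qed
  then show "point_eval (mscale (\<lambda>i. if i = 0 then 2 ^ k else 2) (msubst linearizer P)) x =
    point_eval (mconst (2 ^ ((k + 1) * d)) * msubst linearizer P) x"
    by (simp only: power_mult point_eval_mscale point_eval_msubst point.meval_mult
        point.meval_single monomial_eval_zero mult_1_right)
qed

lemma mscale_linearizer_outside:
  assumes P: "P \<in> forms n d" and j: "j > n"
  shows "mscale (\<lambda>i. if i = j then 2 else 1) (msubst linearizer P) = msubst linearizer P"
proof (rule mpoly_eq_iff[THEN iffD2, rule_format])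
  fix x :: "nat \<Rightarrow> complex"
  have "point_eval P (\<lambda>i. point_eval (linearizer i) (\<lambda>i. (if i = j then 2 else 1) * x i)) =
      point_eval P (\<lambda>i. point_eval (linearizer i) x)"
  proof (rule point_eval_form_cong[OF P])
    fix i assume "i \<le> n"
    moreover have "(\<Sum>i=1..n. ((if i = j then 2 else 1) * x i) ^ (k + 1)) = (\<Sum>i=1..n. x i ^ (k + 1))"
      using j by (intro sum.cong) auto
    ultimately show "point_eval (linearizer i) (\<lambda>i. (if i = j then 2 else 1) * x i) =
        point_eval (linearizer i) x"
      using j unfolding point_eval_linearizer by auto
  qed
  then show "point_eval (mscale (\<lambda>i. if i = j then 2 else 1) (msubst linearizer P)) x =
      point_eval (msubst linearizer P) x"
    by simp
qed

lemma primitive_root: "\<exists>z::complex. z ^ k = 1 \<and> (\<forall>e. z ^ e = 1 \<longrightarrow> k dvd e)"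
proof (intro exI conjI allI impI)
  let ?z = "cis (2 * pi / real k)"
  show "?z ^ k = 1"
    using k by (simp add: DeMoivre)
  fix e assume e: "?z ^ e = 1"
  have "cis (2 * pi * real_of_int (int e mod int k) / real k) = cis (2 * pi * real_of_int 0 / real k)"
    unfolding cis_mod[OF k] using e by (simp add: DeMoivre mult_ac)
  moreover have "int e mod int k \<in> {0..<int k}" "0 \<in> {0..<int k}"
    using k by auto
  ultimately have "int e mod int k = 0"
    using bij_betw_imp_inj_on[OF cis_bij[OF k]] by (meson inj_onD)
  then show "k dvd e"
    by (metis dvd_eq_mod_eq_0 of_nat_dvd_iff)
qed

text \<open>A fraction fixed by all deck transformations becomes, in linearized form, a quotient of two
  invariant polynomials, once it is extended by the conjugates of its denominator. Invariant
  polynomials involve only the \<open>k\<close>-th powers of the variables; undoing the linearization turns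
  these into the components of the Gauss map.\<close>

lemma invariant_fraction:
  assumes P: "P \<in> forms n d" and Q: "Q \<in> forms n d" "Q \<noteq> 0"
    and inv: "\<And>\<zeta>. \<zeta> \<in> roots_group \<Longrightarrow> msubst (\<delta> \<zeta>) P * Q = P * msubst (\<delta> \<zeta>) Q"
  shows "\<exists>e. \<exists>A\<in>forms n e. \<exists>B\<in>forms n e. B \<noteq> 0 \<and> msubst G A * Q = P * msubst G B"
proof -
  define P' where "P' = msubst linearizer P"
  define Q' where "Q' = msubst linearizer Q"
  have Q': "Q' \<noteq> 0"
    unfolding Q'_def using Q by (rule msubst_linearizer_neq_0)
  have inv': "mscale (torus \<zeta>) P' * Q' = P' * mscale (torus \<zeta>) Q'" if \<zeta>: "\<zeta> \<in> roots_group" for \<zeta>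
  proof -
    let ?c = "(mvar 0 ^ (k + 1) * F) ^ d"
    have "msubst linearizer (msubst (\<delta> \<zeta>) P) * Q' = P' * msubst linearizer (msubst (\<delta> \<zeta>) Q)"
      using arg_cong[OF inv[OF \<zeta>], of "msubst linearizer"] by (simp add: P'_def Q'_def)
    then have "?c * (mscale (torus \<zeta>) P' * Q') = ?c * (P' * mscale (torus \<zeta>) Q')"
      unfolding deck_linearizer[OF P unity_roots_group[OF \<zeta>]] deck_linearizer[OF Q(1) unity_roots_group[OF \<zeta>]]
      by (simp add: P'_def Q'_def mult_ac)
    moreover have "?c \<noteq> 0"
      using F_neq_0 by simp
    ultimately show ?thesis
      using mult_left_cancel by blast
  qed
  define N where "N = (\<Prod>\<zeta>\<in>roots_group. mscale (torus \<zeta>) Q')"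
  define one where "one = restrict (\<lambda>_. 1 :: complex) {1..n}"
  have one: "one \<in> roots_group"
    unfolding one_def by (rule restrict_roots_group) simp
  have torus_one: "torus one = (\<lambda>_. 1)"
    unfolding one_def torus_restrict by (auto simp: torus_def)
  define M where "M = P' * (\<Prod>\<zeta>\<in>roots_group - {one}. mscale (torus \<zeta>) Q')"
  have "N = Q' * (\<Prod>\<zeta>\<in>roots_group - {one}. mscale (torus \<zeta>) Q')"
    unfolding N_def using one
    by (subst prod.remove[OF finite_roots_group one]) (simp add: torus_one mscale_one)
  then have MN: "M * Q' = P' * N"
    by (simp add: M_def mult_ac)
  have N: "N \<noteq> 0"
    unfolding N_def using finite_roots_group Q' torus_neq_0 unity_roots_group
    by (auto simp: mscale_eq_0_iff)
  have N_inv: "mscale (torus \<eta>) N = N" if \<eta>: "\<eta> \<in> roots_group" for \<eta>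
  proof -
    let ?f = "\<lambda>\<zeta>. restrict (\<lambda>i. \<eta> i * \<zeta> i) {1..n}"
    have "inj_on ?f roots_group"
    proof (rule inj_onI)
      fix \<zeta> \<xi> assume *: "\<zeta> \<in> roots_group" "\<xi> \<in> roots_group" "?f \<zeta> = ?f \<xi>"
      show "\<zeta> = \<xi>"
      proof (rule PiE_ext[OF *(1,2)[unfolded roots_group_def]])
        fix i assume i: "i \<in> {1..n}"
        then have "\<eta> i * \<zeta> i = \<eta> i * \<xi> i"
          using fun_cong[OF *(3), of i] by simp
        then show "\<zeta> i = \<xi> i"
          using unity_tuple_neq_0[OF k unity_roots_group[OF \<eta>] i] by simp
      qed
    qed
    moreover have "?f ` roots_group \<subseteq> roots_group"
      using \<eta> by (intro image_subsetI restrict_roots_group unity_tuple_mult unity_roots_group)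
    ultimately have bij: "bij_betw ?f roots_group roots_group"
      using finite_roots_group by (simp add: bij_betw_def endo_inj_surj)
    have "mscale (torus \<eta>) N = (\<Prod>\<zeta>\<in>roots_group. mscale (torus (?f \<zeta>)) Q')"
      unfolding N_def mscale_prod mscale_mscale torus_restrict torus_mult ..
    also have "\<dots> = N"
      unfolding N_def by (rule prod.reindex_bij_betw[OF bij])
    finally show ?thesis .
  qed
  \<comment> \<open>The weight of \<open>N\<close>, as \<open>x\<^sub>0\<close> has weight \<open>k\<close> and so the linearized forms have weight \<open>(k + 1) d\<close>.\<close>
  define w where "w = (k + 1) * d * card roots_group"
  have N_scale: "mscale c N = mconst (a ^ card roots_group) * N" if "mscale c Q' = mconst a * Q'" for c a
  proof -
    have "mscale c (mscale (torus \<zeta>) Q') = mconst a * mscale (torus \<zeta>) Q'" for \<zeta>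
    proof -
      have "mscale c (mscale (torus \<zeta>) Q') = mscale (torus \<zeta>) (mscale c Q')"
        by (simp add: mscale_mscale mult.commute)
      then show ?thesis
        by (simp add: that mscale_mult)
    qed
    then have "mscale c N = (\<Prod>\<zeta>\<in>roots_group. mconst a * mscale (torus \<zeta>) Q')"
      by (simp add: N_def mscale_prod)
    also have "\<dots> = mconst (a ^ card roots_group) * N"
      by (simp add: N_def prod.distrib mpoly_eq_iff)
    finally show ?thesis .
  qed
  let ?cw = "\<lambda>i. if i = 0 then 2 ^ k else 2 :: complex"
  have N_weight: "mscale ?cw N = mconst (2 ^ w) * N"
    using N_scale[OF mscale_linearizer_weight[OF Q(1), folded Q'_def]] by (simp add: w_def power_mult)
  have P_weight: "mscale ?cw P' * Q' = P' * mscale ?cw Q'"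
    unfolding P'_def Q'_def mscale_linearizer_weight[OF P] mscale_linearizer_weight[OF Q(1)]
    by (simp add: mult_ac)
  \<comment> \<open>Invariance under rescaling one variable beyond \<open>x\<^sub>n\<close> says that it does not occur.\<close>
  let ?cj = "\<lambda>j i. if i = j then 2 else 1 :: complex"
  have N_out: "mscale (?cj j) N = mconst 1 * N" if "j > n" for j
    using N_scale[of "?cj j" 1] mscale_linearizer_outside[OF Q(1) that, folded Q'_def] by simp
  have P_out: "mscale (?cj j) P' * Q' = P' * mscale (?cj j) Q'" if "j > n" for j
    unfolding P'_def Q'_def mscale_linearizer_outside[OF P that] mscale_linearizer_outside[OF Q(1) that] ..
  note numerator = semi_invariant_numerator[OF MN Q']
  have exponents: "Poly_Mapping.keys m \<subseteq> {..n}"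
      "i \<in> {1..n} \<Longrightarrow> k dvd Poly_Mapping.lookup m i"
      "(\<Sum>i\<le>n. (if i = 0 then k else 1) * Poly_Mapping.lookup m i) = w"
    if R: "R = M \<or> R = N" and m: "m \<in> Poly_Mapping.keys R" for R m i
  proof -
    have weight: "monomial_eval c m = a" if "mscale c R = mconst a * R" for c a
    proof (rule weight_of_semi_invariant[OF _ m])
      show "point_eval R (\<lambda>i. c i * x i) = a * point_eval R x" for x
        using arg_cong[OF that, of "\<lambda>p. point_eval p x"] by simp
    qed
    have "Poly_Mapping.lookup m j = 0" if j: "j > n" for j
    proof -
      have "mscale (?cj j) R = mconst 1 * R"
        using R N_out[OF j] numerator[OF _ P_out[OF j] N_out[OF j]] by auto
      then have "(2::complex) ^ Poly_Mapping.lookup m j = 1"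
        using weight monomial_eval_scale_one[of j 2 m] by metis
      then have "norm ((2::complex) ^ Poly_Mapping.lookup m j) = 1"
        by simp
      then show ?thesis
        using power_inject_exp[of "2 :: real" "Poly_Mapping.lookup m j" 0] by (simp add: norm_power)
    qed
    then show sub: "Poly_Mapping.keys m \<subseteq> {..n}"
      by (metis atMost_iff in_keys_iff leI subsetI)
    show "k dvd Poly_Mapping.lookup m i" if i: "i \<in> {1..n}"
    proof -
      obtain z :: complex where z: "z ^ k = 1" "\<And>e. z ^ e = 1 \<Longrightarrow> k dvd e"
        using primitive_root by blast
      define \<zeta> where "\<zeta> = restrict (\<lambda>j. if j = i then z else 1) {1..n}"
      have \<zeta>: "\<zeta> \<in> roots_group"
        unfolding \<zeta>_def using z by (intro restrict_roots_group) (auto simp: unity_tuple_def)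
      have tor: "torus \<zeta> = (\<lambda>j. if j = i then z else 1)"
        using i by (auto simp: \<zeta>_def torus_def)
      have "mscale (torus \<zeta>) R = mconst 1 * R"
        using R N_inv[OF \<zeta>] numerator[OF torus_neq_0[OF unity_roots_group[OF \<zeta>]] inv'[OF \<zeta>], of 1] by auto
      then have "z ^ Poly_Mapping.lookup m i = 1"
        using weight monomial_eval_scale_one[of i z m] unfolding tor by metis
      then show ?thesis
        by (rule z(2))
    qed
    have "mscale ?cw R = mconst (2 ^ w) * R"
      using R N_weight numerator[OF _ P_weight N_weight] by auto
    then have "monomial_eval ?cw m = 2 ^ w"
      by (rule weight)
    moreover have "monomial_eval ?cw m = (\<Prod>i\<le>n. 2 ^ ((if i = 0 then k else 1) * Poly_Mapping.lookup m i))"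
      unfolding monomial_eval_superset[OF _ sub, simplified] by (intro prod.cong) (auto simp: power_mult)
    ultimately have "(2::complex) ^ (\<Sum>i\<le>n. (if i = 0 then k else 1) * Poly_Mapping.lookup m i) = 2 ^ w"
      by (simp only: power_sum)
    then have "norm ((2::complex) ^ (\<Sum>i\<le>n. (if i = 0 then k else 1) * Poly_Mapping.lookup m i)) = norm ((2::complex) ^ w)"
      by (simp only:)
    then show "(\<Sum>i\<le>n. (if i = 0 then k else 1) * Poly_Mapping.lookup m i) = w"
      unfolding norm_power by simp
  qed
  obtain m where m: "m \<in> Poly_Mapping.keys N"
    using N by (metis all_not_in_conv keys_eq_empty)
  have "k dvd (\<Sum>i\<le>n. (if i = 0 then k else 1) * Poly_Mapping.lookup m i)"
    using exponents(2)[OF _ m] by (intro dvd_sum) auto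
  then obtain e where e: "w = k * e"
    using exponents(3)[OF _ m] by auto
  have form: "\<exists>A\<in>forms n e. R = msubst (power_tuple k) A" if R: "R = M \<or> R = N" for R
  proof (rule form_in_power_tuple[OF k])
    fix m assume m: "m \<in> Poly_Mapping.keys R"
    show "Poly_Mapping.keys m \<subseteq> {..n}"
      by (rule exponents(1)[OF R m])
    show "k dvd Poly_Mapping.lookup m i" if "i \<in> {1..n}" for i
      by (rule exponents(2)[OF R m that])
    show "(\<Sum>i\<le>n. (if i = 0 then k else 1) * Poly_Mapping.lookup m i) = k * e"
      unfolding e[symmetric] by (rule exponents(3)[OF R m])
  qed
  obtain A where A: "A \<in> forms n e" "M = msubst (power_tuple k) A"
    using form[of M] by blast
  obtain B where B: "B \<in> forms n e" "N = msubst (power_tuple k) B"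
    using form[of N] by blast
  have "B \<noteq> 0"
    using N B(2) by auto
  moreover have "msubst G A * Q = P * msubst G B"
  proof (rule mpoly_eqI[of "mvar 0 * F"])
    show "mvar 0 * F \<noteq> 0"
      using F_neq_0 by simp
    fix y assume "point_eval (mvar 0 * F) y \<noteq> 0"
    then have y: "y 0 \<noteq> 0" "(\<Sum>i=1..n. y i ^ (k + 1)) \<noteq> 0"
      by simp_all
    define c where "c = (\<Sum>i=1..n. y i ^ (k + 1)) / y 0"
    have c: "c \<noteq> 0"
      using y by (simp add: c_def)
    define x where "x = y(0 := c)"
    have G: "point_eval (msubst G R) y = y 0 ^ e * point_eval (msubst (power_tuple k) R) x"
      if R: "R \<in> forms n e" for R
      unfolding point_eval_msubst
    proof (rule point_eval_form[OF R])
      fix i assume "i \<le> n"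
      then show "point_eval (G i) y = y 0 * point_eval (power_tuple k i) x"
        unfolding point_eval_fermat_form using y(1) by (auto simp: power_tuple_def x_def c_def)
    qed
    have lin: "point_eval P' x = c ^ d * point_eval P y" "point_eval Q' x = c ^ d * point_eval Q y"
      using linearizer_cancel[where y = y, OF P y(1)] linearizer_cancel[where y = y, OF Q(1) y(1)]
      by (simp_all only: P'_def Q'_def x_def c_def)
    have "point_eval M x * point_eval Q' x = point_eval P' x * point_eval N x"
      using MN by (metis point.meval_mult)
    then have "c ^ d * (point_eval M x * point_eval Q y) = c ^ d * (point_eval P y * point_eval N x)"
      unfolding lin by (simp only: mult_ac)
    then have "point_eval M x * point_eval Q y = point_eval P y * point_eval N x"
      using c by simp
    then show "point_eval (msubst G A * Q) y = point_eval (P * msubst G B) y"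
      unfolding point.meval_mult G[OF A(1)] G[OF B(1)] A(2)[symmetric] B(2)[symmetric] by simp
  qed
  ultimately show ?thesis
    using A(1) B(1) by blast
qed

lemma dominating_G: "dominating n G"
  by (rule dominating_fermat_form[OF n_pos k])

lemma dominating_deck_tuple: "unity \<zeta> \<Longrightarrow> dominating n (\<delta> \<zeta>)"
  using ratmap_deck_in_deck_group deck_tuple_in_hom_tuples
  by (intro dominating_if_birational) (auto simp: deck_group_def)

lemma pullback_deck_comp:
  assumes \<zeta>: "unity \<zeta>" and \<eta>: "unity \<eta>" and z: "z \<in> carrier (function_field n)"
  shows "pullback n (ratmap n (\<delta> \<zeta>)) (pullback n (ratmap n (\<delta> \<eta>)) z) =
    pullback n (ratmap n (\<delta> (\<lambda>i. \<eta> i * \<zeta> i))) z"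
proof -
  obtain P Q d where P: "P \<in> forms n d" and Q: "Q \<in> forms n d" "Q \<noteq> 0" and zPQ: "z = Fraction_Field.Fract P Q"
    using z by (rule function_fieldE)
  have \<eta>\<zeta>: "unity (\<lambda>i. \<eta> i * \<zeta> i)"
    using \<eta> \<zeta> by (rule unity_tuple_mult)
  let ?c = "fermat n k \<zeta> * F ^ (k + 1)"
  have c: "?c \<noteq> 0"
    using fermat_unity_neq_0[OF \<zeta>] F_neq_0 by simp
  have forms: "msubst (\<delta> \<eta>) R \<in> forms n (d * (k + 2))" if "R \<in> forms n d" for R
    using that deck_tuple_in_forms by (intro forms_msubst) auto
  have Q\<eta>: "msubst (\<delta> \<eta>) Q \<noteq> 0"
    using dominating_deck_tuple[OF \<eta>] Q by (auto dest: dominatingD)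
  have comp: "msubst (\<delta> \<zeta>) (msubst (\<delta> \<eta>) R) = ?c ^ d * msubst (\<delta> (\<lambda>i. \<eta> i * \<zeta> i)) R" if "R \<in> forms n d" for R
  proof -
    have "msubst (\<delta> \<zeta>) (msubst (\<delta> \<eta>) R) = msubst (\<lambda>i. msubst (\<delta> \<zeta>) (\<delta> \<eta> i)) R"
      by (simp add: mpoly_eq_iff)
    also have "\<dots> = ?c ^ d * msubst (\<delta> (\<lambda>i. \<eta> i * \<zeta> i)) R"
      unfolding deck_tuple_comp[OF \<zeta>] by (rule msubst_mult_form[OF that])
    finally show ?thesis .
  qed
  have "pullback n (ratmap n (\<delta> \<zeta>)) (pullback n (ratmap n (\<delta> \<eta>)) z) =
      Fraction_Field.Fract (msubst (\<delta> \<zeta>) (msubst (\<delta> \<eta>) P)) (msubst (\<delta> \<zeta>) (msubst (\<delta> \<eta>) Q))"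
    unfolding zPQ
      pullback_Fract[OF deck_tuple_in_hom_tuples[OF \<eta>] dominating_deck_tuple[OF \<eta>] P Q]
      pullback_Fract[OF deck_tuple_in_hom_tuples[OF \<zeta>] dominating_deck_tuple[OF \<zeta>] forms[OF P] forms[OF Q(1)] Q\<eta>] ..
  also have "\<dots> = Fraction_Field.Fract (msubst (\<delta> (\<lambda>i. \<eta> i * \<zeta> i)) P) (msubst (\<delta> (\<lambda>i. \<eta> i * \<zeta> i)) Q)"
    unfolding comp[OF P] comp[OF Q(1)] using c by (intro mult_fract_cancel) simp
  also have "\<dots> = pullback n (ratmap n (\<delta> (\<lambda>i. \<eta> i * \<zeta> i))) z"
    unfolding zPQ
      pullback_Fract[OF deck_tuple_in_hom_tuples[OF \<eta>\<zeta>] dominating_deck_tuple[OF \<eta>\<zeta>] P Q] ..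
  finally show ?thesis .
qed

lemma pullback_deck_one:
  assumes z: "z \<in> carrier (function_field n)"
  shows "pullback n (ratmap n (\<delta> (\<lambda>_. 1))) z = z"
proof -
  obtain P Q d where P: "P \<in> forms n d" and Q: "Q \<in> forms n d" "Q \<noteq> 0" and zPQ: "z = Fraction_Field.Fract P Q"
    using z by (rule function_fieldE)
  have id: "msubst (id_tuple n) R = R" if "R \<in> forms n d" for R
  proof (rule mpoly_eq_iff[THEN iffD2, rule_format])
    fix x :: "nat \<Rightarrow> complex"
    show "point_eval (msubst (id_tuple n) R) x = point_eval R x"
      unfolding point_eval_msubst by (rule point_eval_form_cong[OF that]) (simp add: id_tuple_def)
  qed
  show ?thesis
    unfolding zPQ ratmap_deck_one ratmap_id_eq
      pullback_Fract[OF id_tuple_in_hom_tuples dominating_id_tuple P Q] id[OF P] id[OF Q(1)] ..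
qed

theorem galois_over_pullback:
  "ring.galois_over (function_field n) (pullback n (ratmap n G) ` carrier (function_field n))"
proof (rule field.galois_over_fixed_field[OF field_function_field
      subfield_pullback[OF G_in_hom_tuples dominating_G]])
  let ?R = "function_field n" and ?K = "pullback n (ratmap n G) ` carrier (function_field n)"
  let ?S = "(\<lambda>\<zeta>. pullback n (ratmap n (\<delta> \<zeta>))) ` roots_group"
  have restr: "\<delta> (restrict \<zeta> {1..n}) = \<delta> \<zeta>" for \<zeta>
    by (rule deck_tuple_cong) simp
  show "finite ?S"
    by (intro finite_imageI finite_roots_group)
  show "s \<in> ring_hom ?R ?R" if "s \<in> ?S" for s
    using that by (auto intro!: pullback_ring_hom deck_tuple_in_hom_tuples dominating_deck_tuple unity_roots_group)
  show "\<exists>e\<in>?S. \<forall>z\<in>carrier ?R. e z = z"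
  proof (rule bexI)
    show "pullback n (ratmap n (\<delta> (restrict (\<lambda>_. 1) {1..n}))) \<in> ?S"
      by (intro imageI restrict_roots_group) simp
    show "\<forall>z\<in>carrier ?R. pullback n (ratmap n (\<delta> (restrict (\<lambda>_. 1) {1..n}))) z = z"
      unfolding restr using pullback_deck_one by blast
  qed
  show "\<exists>u\<in>?S. \<forall>z\<in>carrier ?R. s (t z) = u z" if st: "s \<in> ?S" "t \<in> ?S" for s t
  proof -
    obtain \<zeta> \<eta> where *: "unity \<zeta>" "unity \<eta>"
      "s = pullback n (ratmap n (\<delta> \<zeta>))" "t = pullback n (ratmap n (\<delta> \<eta>))"
      using st unity_roots_group by auto
    show ?thesis
    proof (rule bexI)
      show "pullback n (ratmap n (\<delta> (restrict (\<lambda>i. \<eta> i * \<zeta> i) {1..n}))) \<in> ?S"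
        using * by (intro imageI restrict_roots_group unity_tuple_mult)
      show "\<forall>z\<in>carrier ?R. s (t z) = pullback n (ratmap n (\<delta> (restrict (\<lambda>i. \<eta> i * \<zeta> i) {1..n}))) z"
        unfolding restr *(3,4) using pullback_deck_comp[OF *(1,2)] by blast
    qed
  qed
  show "z \<in> ?K" if z: "z \<in> carrier ?R" and fixed: "\<And>s. s \<in> ?S \<Longrightarrow> s z = z" for z
  proof -
    obtain P Q d where P: "P \<in> forms n d" and Q: "Q \<in> forms n d" "Q \<noteq> 0" and zPQ: "z = Fraction_Field.Fract P Q"
      using z by (rule function_fieldE)
    have "msubst (\<delta> \<zeta>) P * Q = P * msubst (\<delta> \<zeta>) Q" if \<zeta>: "\<zeta> \<in> roots_group" for \<zeta>
    proof -
      note u = unity_roots_group[OF \<zeta>]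
      have nz: "msubst (\<delta> \<zeta>) Q \<noteq> 0"
        using dominating_deck_tuple[OF u] Q by (auto dest: dominatingD)
      have "pullback n (ratmap n (\<delta> \<zeta>)) z = z"
        using \<zeta> by (intro fixed imageI)
      then have "Fraction_Field.Fract (msubst (\<delta> \<zeta>) P) (msubst (\<delta> \<zeta>) Q) = Fraction_Field.Fract P Q"
        unfolding zPQ pullback_Fract[OF deck_tuple_in_hom_tuples[OF u] dominating_deck_tuple[OF u] P Q] .
      then show ?thesis
        using nz Q(2) by (simp add: eq_fract(1))
    qed
    then obtain e A B where AB: "A \<in> forms n e" "B \<in> forms n e" "B \<noteq> 0"
      and eq: "msubst G A * Q = P * msubst G B"
      using invariant_fraction[OF P Q] by blast
    have "msubst G B \<noteq> 0"
      using dominating_G AB by (auto dest: dominatingD)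
    then have "z = pullback n (ratmap n G) (Fraction_Field.Fract A B)"
      unfolding zPQ pullback_Fract[OF G_in_hom_tuples dominating_G AB] using Q(2) eq
      by (simp add: eq_fract(1))
    then show ?thesis
      using function_fieldI[OF AB] by blast
  qed
qed

end

theorem corollary6p20:
  fixes n k :: nat and F :: mpoly
  assumes "n \<ge> 2" and "k \<ge> 1"
    and F: "F = (\<Sum>i=1..n. mvar i ^ (k + 1))"
  shows "(\<exists>\<omega>. codim1_foliation n \<omega> \<and> polynomial_first_integral n \<omega> F) \<and>
    (\<forall>\<omega>. codim1_foliation n \<omega> \<and> polynomial_first_integral n \<omega> F \<longrightarrow>
       galois_foliation n \<omega> \<and>
       deck_group n (gauss_map n \<omega>) \<cong> product_group {..<n - 1} (\<lambda>_. integer_mod_group k))"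
proof -
  interpret fermat_foliation n k
    using assms by unfold_locales
  have F': "F = fermat n k (\<lambda>_. 1)"
    by (simp only: F fermat_one)
  have "galois_foliation n \<omega> \<and>
      deck_group n (gauss_map n \<omega>) \<cong> product_group {..<n - 1} (\<lambda>_. integer_mod_group k)"
    if \<omega>: "codim1_foliation n \<omega>" "polynomial_first_integral n \<omega> F" for \<omega>
  proof -
    have "(\<omega>, fermat_form n k) \<in> proportional n"
      using proportional_fermat_form[OF n_pos \<omega>(1)] \<omega>(2) by (simp add: F')
    then have gauss: "gauss_map n \<omega> = ratmap n (fermat_form n k)"
      by (simp add: gauss_map_def ratmap_eq_iff proportional_def)
    show ?thesis
      unfolding galois_foliation_def nondegenerate_foliation_def gauss
      using dominant_ratmap[OF G_in_hom_tuples dominating_G] galois_over_pullback deck_group_iso by blast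
  qed
  moreover have "codim1_foliation n (fermat_form n k)" "polynomial_first_integral n (fermat_form n k) F"
    unfolding F' using assms n_pos by (auto intro: codim1_foliation_fermat_form first_integral_fermat_form)
  ultimately show ?thesis
    by blast
qed

end
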